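(* Let $(P,L,f)$ be a countable extended PO system, $\mathscr{Z}$ a bounded trim $(P,L,f)$-partition of the $\omega$-Stone space $W$, $Q$ a countable PO system, and $\alpha\colon Q\to P$ a surjective morphism. Then $\mathscr{Z}$ can be regularly refined via $\alpha$ to a trim $Q$-partition of $W$ (that is, there is a trim $Q$-partition $\mathscr{Y}$ of $W$ with $\mathscr{Y}\prec_\alpha\mathscr{Z}$) iff both of the following hold: (a) $L\alpha^{-1}$ has a finite foundation; (b) $|Q(p)|\leqslant f(p)$ for all $p\in L_{\min}^{d}$, where $Q(p)=\{q\in Q\mid q\alpha=p\}$.
   Context: Maps are written on the right. A PO system is a set $P$ with an antisymmetric transitive relation $<$ (possibly $p<p$ for some $p$); $p\leqslant q$ means $p<q$ or $p=q$; $P^{d}=\{p\in P: p\nless p\}$; $p_{\uparrow}=\{q\in P: q\geqslant p\}$; for $S\subseteq P$, $S_\downarrow=\{p: p\leqslant s\text{ for some }s\in S\}$ and $S_\uparrow=\{p:p\geqslant s\text{ for some }s\in S\}$. $S$ is a lower subset if $S=S_\downarrow$. $F$ is a finite foundation of $S\subseteq P$ if $F$ is a finite subset of $S_\downarrow$ with $S_\downarrow\subseteq F_\uparrow$. $P_\Delta=\{p\in P:\{p\}\text{ has a finite foundation}\}$. A morphism $\alpha\colon Q\to P$ is a map such that for each $q\in Q$, $\{r\in Q: r>q\}\alpha=\{p\in P: p>q\alpha\}$. A Stone space $W$ is a locally compact Hausdorff space with a base of compact open sets (the Stone space of a Boolean ring, possibly without $1$); $W$ is an $\omega$-Stone space if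 it has only countably many compact open subsets. $\{X_p\mid p\in P\}^{*}$ denotes a family of pairwise disjoint non-empty subsets $X_p$ of $W$ together with the remaining set $W-X$ (possibly empty), where $X=\bigcup_p X_p$. With $S'$ the set of limit points of $S$, it is a $P$-partition if $X_p'\cap X=\bigcup_{q<p}X_q$ for all $p\in P$. For $Y\subseteq W$ its type is $T_{\mathscr{X}}(Y)=\{p: Y\cap X_p\neq\emptyset\}$. A compact open $A$ is $p$-trim if $T_{\mathscr{X}}(A)=p_{\uparrow}$ and, if $p\in P^d$, also $|A\cap X_p|=1$; $\mathrm{Trim}_p(\mathscr{X})$ is the set of $p$-trim sets; a set is trim if it is $p$-trim for some $p$; $\widehat{P}$ is the set of $p$ for which there is a $p$-trim set. A trim $P$-partition is a $P$-partition such that: (T1) every element of $W$ has a neighbourhood base of trim sets; (T2) for each $p\in\widehat P$, every element of $W$ with a neighbourhood base of $p$-trim sets lies in $X_p$; (T3) every point of each $X_p$ has a $p$-trim neighbourhood. An extended PO system is a triple $(P,L,f)$ where $P$ is a PO system, $L$ is a lower subset of $P$ with $L\subseteq P_\Delta$, and $f\colon L_{\min}^d\to\mathbb{N}_+$, where $L_{\min}^d=L_{\min}\cap P^d$ and $L_{\min}$ is the set of minimal elements of $(L,\leqslant)$. A trim $P$-partition $\{Z_p\mid p\in P\}^*$ is a trim $(P,L,f)$-partition if $\overline{Z_p}$ is compact precisely when $p\in L$, and $|Z_p|=f(p)$ for $p\in L_{\min}^d$; it is a bounded trim $(P,L,f)$-partition if in addition the closure of $\bigcup_{p\in L}Z_p$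 is compact. For a $P$-partition $\mathscr{Z}=\{Z_p\}^*$ and $Q$-partition $\mathscr{Y}=\{Y_q\}^*$ of $W$ satisfying T1, $\mathscr{Y}\prec_\alpha\mathscr{Z}$ ($\mathscr{Y}$ regularly refines $\mathscr{Z}$ via $\alpha\colon Q\to P$) means that $Y_q\subseteq Z_{q\alpha}$ for all $q\in Q$, and $p\in T_{\mathscr{Y}}(A)\alpha$ for all $p\in\widehat P$ and $A\in\mathrm{Trim}_p(\mathscr{Z})$. *)

theory Defs
  imports "HOL-Analysis.Abstract_Topology" "HOL-Analysis.Abstract_Topological_Spaces"
begin

section \<open>PO systems\<close>

text \<open>
  A PO system is given by a carrier \<open>P\<close> (possibly empty) and a relation \<open>lt\<close>, of which only the
  restriction to \<open>P\<close> matters. The relation need not be irreflexive, so antisymmetry does not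
  exclude \<open>lt p p\<close>.
\<close>

definition po_system :: "'p set \<Rightarrow> ('p \<Rightarrow> 'p \<Rightarrow> bool) \<Rightarrow> bool" where
  "po_system P lt \<longleftrightarrow> antisymp_on P lt \<and> transp_on P lt"

definition po_le :: "('p \<Rightarrow> 'p \<Rightarrow> bool) \<Rightarrow> 'p \<Rightarrow> 'p \<Rightarrow> bool" where
  "po_le lt p q \<longleftrightarrow> lt p q \<or> p = q"

definition po_discrete :: "'p set \<Rightarrow> ('p \<Rightarrow> 'p \<Rightarrow> bool) \<Rightarrow> 'p set" where
  "po_discrete P lt = {p \<in> P. \<not> lt p p}"

definition down_set :: "'p set \<Rightarrow> ('p \<Rightarrow> 'p \<Rightarrow> bool) \<Rightarrow> 'p set \<Rightarrow> 'p set" where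
  "down_set P lt S = {p \<in> P. \<exists>s\<in>S. po_le lt p s}"

definition up_set :: "'p set \<Rightarrow> ('p \<Rightarrow> 'p \<Rightarrow> bool) \<Rightarrow> 'p set \<Rightarrow> 'p set" where
  "up_set P lt S = {p \<in> P. \<exists>s\<in>S. po_le lt s p}"

definition lower_subset :: "'p set \<Rightarrow> ('p \<Rightarrow> 'p \<Rightarrow> bool) \<Rightarrow> 'p set \<Rightarrow> bool" where
  "lower_subset P lt S \<longleftrightarrow> S \<subseteq> P \<and> S = down_set P lt S"

definition finite_foundation ::
    "'p set \<Rightarrow> ('p \<Rightarrow> 'p \<Rightarrow> bool) \<Rightarrow> 'p set \<Rightarrow> 'p set \<Rightarrow> bool" where
  "finite_foundation P lt S F \<longleftrightarrow>
     finite F \<and> F \<subseteq> down_set P lt S \<and> down_set P lt S \<subseteq> up_set P lt F"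

definition has_finite_foundation :: "'p set \<Rightarrow> ('p \<Rightarrow> 'p \<Rightarrow> bool) \<Rightarrow> 'p set \<Rightarrow> bool" where
  "has_finite_foundation P lt S \<longleftrightarrow> (\<exists>F. finite_foundation P lt S F)"

definition po_Delta :: "'p set \<Rightarrow> ('p \<Rightarrow> 'p \<Rightarrow> bool) \<Rightarrow> 'p set" where
  "po_Delta P lt = {p \<in> P. has_finite_foundation P lt {p}}"

definition po_minimals :: "('p \<Rightarrow> 'p \<Rightarrow> bool) \<Rightarrow> 'p set \<Rightarrow> 'p set" where
  "po_minimals lt L = {p \<in> L. \<forall>q\<in>L. po_le lt q p \<longrightarrow> q = p}"

definition po_discrete_minimals ::
    "'p set \<Rightarrow> ('p \<Rightarrow> 'p \<Rightarrow> bool) \<Rightarrow> 'p set \<Rightarrow> 'p set" where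
  "po_discrete_minimals P lt L = po_minimals lt L \<inter> po_discrete P lt"

definition po_morphism ::
    "'q set \<Rightarrow> ('q \<Rightarrow> 'q \<Rightarrow> bool) \<Rightarrow> 'p set \<Rightarrow> ('p \<Rightarrow> 'p \<Rightarrow> bool) \<Rightarrow> ('q \<Rightarrow> 'p) \<Rightarrow> bool" where
  "po_morphism Q ltQ P ltP \<alpha> \<longleftrightarrow>
     \<alpha> ` Q \<subseteq> P \<and> (\<forall>q\<in>Q. \<alpha> ` {r \<in> Q. ltQ q r} = {p \<in> P. ltP (\<alpha> q) p})"

text \<open>The function \<open>f\<close> is total here; its values off the discrete minimal elements of \<open>L\<close> are
  never used.\<close>

definition extended_po_system ::
    "'p set \<Rightarrow> ('p \<Rightarrow> 'p \<Rightarrow> bool) \<Rightarrow> 'p set \<Rightarrow> ('p \<Rightarrow> nat) \<Rightarrow> bool" where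
  "extended_po_system P lt L f \<longleftrightarrow>
     po_system P lt \<and> lower_subset P lt L \<and> L \<subseteq> po_Delta P lt \<and>
     (\<forall>p\<in>po_discrete_minimals P lt L. 0 < f p)"


section \<open>Stone spaces of Boolean rings\<close>

definition compact_open_in :: "'a topology \<Rightarrow> 'a set \<Rightarrow> bool" where
  "compact_open_in W A \<longleftrightarrow> compactin W A \<and> openin W A"

definition stone_space :: "'a topology \<Rightarrow> bool" where
  "stone_space W \<longleftrightarrow>
     locally_compact_space W \<and> Hausdorff_space W \<and>
     openin W = arbitrary union_of (compact_open_in W)"

definition omega_stone_space :: "'a topology \<Rightarrow> bool" where
  "omega_stone_space W \<longleftrightarrow> stone_space W \<and> countable {A. compact_open_in W A}"


section \<open>Partitions\<close>

text \<open>
  The remaining set of points of \<open>W\<close> lying in no \<open>X p\<close> is determined by \<open>X\<close> and left implicit.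
\<close>

definition po_partition ::
    "'a topology \<Rightarrow> 'p set \<Rightarrow> ('p \<Rightarrow> 'p \<Rightarrow> bool) \<Rightarrow> ('p \<Rightarrow> 'a set) \<Rightarrow> bool" where
  "po_partition W P lt X \<longleftrightarrow>
     (\<forall>p\<in>P. X p \<noteq> {} \<and> X p \<subseteq> topspace W) \<and>
     disjoint_family_on X P \<and>
     (\<forall>p\<in>P. W derived_set_of (X p) \<inter> (\<Union>q\<in>P. X q) = (\<Union>q\<in>{q \<in> P. lt q p}. X q))"

definition type_of_set :: "'p set \<Rightarrow> ('p \<Rightarrow> 'a set) \<Rightarrow> 'a set \<Rightarrow> 'p set" where
  "type_of_set P X Y = {p \<in> P. Y \<inter> X p \<noteq> {}}"

definition Trim ::
    "'a topology \<Rightarrow> 'p set \<Rightarrow> ('p \<Rightarrow> 'p \<Rightarrow> bool) \<Rightarrow> ('p \<Rightarrow> 'a set) \<Rightarrow> 'p \<Rightarrow> 'a set set" where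
  "Trim W P lt X p =
     {A. compact_open_in W A \<and> type_of_set P X A = up_set P lt {p} \<and>
         (p \<in> po_discrete P lt \<longrightarrow> card (A \<inter> X p) = 1)}"

definition po_hat ::
    "'a topology \<Rightarrow> 'p set \<Rightarrow> ('p \<Rightarrow> 'p \<Rightarrow> bool) \<Rightarrow> ('p \<Rightarrow> 'a set) \<Rightarrow> 'p set" where
  "po_hat W P lt X = {p \<in> P. Trim W P lt X p \<noteq> {}}"

definition trim_T1 ::
    "'a topology \<Rightarrow> 'p set \<Rightarrow> ('p \<Rightarrow> 'p \<Rightarrow> bool) \<Rightarrow> ('p \<Rightarrow> 'a set) \<Rightarrow> bool" where
  "trim_T1 W P lt X \<longleftrightarrow>
     (\<forall>w\<in>topspace W. neighbourhood_base_at w (\<lambda>A. \<exists>p\<in>P. A \<in> Trim W P lt X p) W)"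

definition trim_T2 ::
    "'a topology \<Rightarrow> 'p set \<Rightarrow> ('p \<Rightarrow> 'p \<Rightarrow> bool) \<Rightarrow> ('p \<Rightarrow> 'a set) \<Rightarrow> bool" where
  "trim_T2 W P lt X \<longleftrightarrow>
     (\<forall>p\<in>po_hat W P lt X. \<forall>w\<in>topspace W.
        neighbourhood_base_at w (\<lambda>A. A \<in> Trim W P lt X p) W \<longrightarrow> w \<in> X p)"

text \<open>Trim sets are open, so such a set is a neighbourhood of each of its points.\<close>

definition trim_T3 ::
    "'a topology \<Rightarrow> 'p set \<Rightarrow> ('p \<Rightarrow> 'p \<Rightarrow> bool) \<Rightarrow> ('p \<Rightarrow> 'a set) \<Rightarrow> bool" where
  "trim_T3 W P lt X \<longleftrightarrow> (\<forall>p\<in>P. \<forall>x\<in>X p. \<exists>A\<in>Trim W P lt X p. x \<in> A)"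

definition trim_partition ::
    "'a topology \<Rightarrow> 'p set \<Rightarrow> ('p \<Rightarrow> 'p \<Rightarrow> bool) \<Rightarrow> ('p \<Rightarrow> 'a set) \<Rightarrow> bool" where
  "trim_partition W P lt X \<longleftrightarrow>
     po_partition W P lt X \<and> trim_T1 W P lt X \<and> trim_T2 W P lt X \<and> trim_T3 W P lt X"

text \<open>Since \<open>f p\<close> is positive where it is used, the cardinality condition forces \<open>Z p\<close> to be
  finite.\<close>

definition trim_ext_partition ::
    "'a topology \<Rightarrow> 'p set \<Rightarrow> ('p \<Rightarrow> 'p \<Rightarrow> bool) \<Rightarrow> 'p set \<Rightarrow> ('p \<Rightarrow> nat) \<Rightarrow>
       ('p \<Rightarrow> 'a set) \<Rightarrow> bool" where
  "trim_ext_partition W P lt L f Z \<longleftrightarrow>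
     trim_partition W P lt Z \<and>
     (\<forall>p\<in>P. compactin W (W closure_of (Z p)) \<longleftrightarrow> p \<in> L) \<and>
     (\<forall>p\<in>po_discrete_minimals P lt L. card (Z p) = f p)"

definition bounded_trim_ext_partition ::
    "'a topology \<Rightarrow> 'p set \<Rightarrow> ('p \<Rightarrow> 'p \<Rightarrow> bool) \<Rightarrow> 'p set \<Rightarrow> ('p \<Rightarrow> nat) \<Rightarrow>
       ('p \<Rightarrow> 'a set) \<Rightarrow> bool" where
  "bounded_trim_ext_partition W P lt L f Z \<longleftrightarrow>
     trim_ext_partition W P lt L f Z \<and> compactin W (W closure_of (\<Union>p\<in>L. Z p))"

definition regularly_refines ::
    "'a topology \<Rightarrow> 'q set \<Rightarrow> ('q \<Rightarrow> 'q \<Rightarrow> bool) \<Rightarrow> ('q \<Rightarrow> 'a set) \<Rightarrow> ('q \<Rightarrow> 'p) \<Rightarrow>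
       'p set \<Rightarrow> ('p \<Rightarrow> 'p \<Rightarrow> bool) \<Rightarrow> ('p \<Rightarrow> 'a set) \<Rightarrow> bool" where
  "regularly_refines W Q ltQ Y \<alpha> P ltP Z \<longleftrightarrow>
     po_partition W Q ltQ Y \<and> trim_T1 W Q ltQ Y \<and>
     po_partition W P ltP Z \<and> trim_T1 W P ltP Z \<and>
     \<alpha> ` Q \<subseteq> P \<and>
     (\<forall>q\<in>Q. Y q \<subseteq> Z (\<alpha> q)) \<and>
     (\<forall>p\<in>po_hat W P ltP Z. \<forall>A\<in>Trim W P ltP Z p. p \<in> \<alpha> ` type_of_set Q Y A)"

end

theory Submission
  imports Defs "HOL-Library.Nat_Bijection"
begin

text \<open>
  The \<open>Y q\<close> of a refinement are pairwise disjoint nonempty subsets of \<open>Z (\<alpha> q)\<close>, which bounds the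
  number of \<open>q\<close> over a \<open>p\<close> with finite \<open>Z p\<close>. By regularity, a trim set of \<open>Y\<close> that meets the
  compact closure of the \<open>Z p\<close> with \<open>p \<in> L\<close> has its label over \<open>L\<close>; finitely many of these sets
  cover the closure, and their labels are a finite foundation
  (\<open>refined_imp_finite_foundation\<close>, \<open>refined_imp_fibre_bound\<close>).

  Conversely, \<open>Y\<close> is built directly in \<open>W\<close>. Consider finite disjoint families of sets \<open>A\<close>
  labelled by elements \<open>q\<close> of \<open>Q\<close>, where \<open>A\<close> is \<open>\<alpha> q\<close>-trim with respect to \<open>Z\<close>, and refine them
  step by step. A set labelled \<open>q\<close> is split into pieces with labels at least \<open>q\<close>, one of them
  labelled \<open>q\<close> again (exactly one if \<open>q\<close> is discrete), and each \<open>r > q\<close> occurs below it sooner or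
  later. If every compact open set is eventually a union of members, let \<open>Y q\<close> consist of the points
  whose label is \<open>q\<close> from some stage on. By compactness each \<open>q\<close>-labelled member contains a
  point of \<open>Y q\<close>, so that its type is the set of labels from \<open>q\<close> upwards and it is \<open>q\<close>-trim for
  \<open>Y\<close>. The members thus form a base of sets that are trim for \<open>Y\<close> and for \<open>Z\<close> at once, with
  labels corresponding under \<open>\<alpha>\<close>, and this gives both the trimness of \<open>Y\<close> and the regular refinement
  (\<open>limit_class_trim_partition\<close>, \<open>limit_class_regularly_refines\<close>).

  The splitting steps are always possible. A compact open set is a finite disjoint union of trim sets
  (\<open>compact_open_disjoint_trims\<close>), and the labels in \<open>P\<close> of the pieces of a \<open>q\<close>-labelled set lift
  to labels above \<open>q\<close> because \<open>\<alpha>\<close> is a morphism (\<open>label_decomposition\<close>).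

  The two conditions serve to make every \<open>Y q\<close> nonempty, that is, to have a label below every \<open>q\<close>.
  For \<open>\<alpha> q \<notin> L\<close>, the set \<open>Z (\<alpha> q)\<close> lies in no compact set, so a set with label \<open>q\<close> can be added outside
  the part of \<open>W\<close> treated so far. For \<open>\<alpha> q \<in> L\<close> the initial family has to provide the label, and it
  suffices that the elements of a finite foundation are labels of it. Disjoint sets with
  these labels exist if there are enough points in each \<open>Z p\<close> concerned. This can only fail when
  \<open>Z p\<close> is finite, in which case \<open>p\<close> is a discrete minimal element of \<open>L\<close> and the cardinality
  condition applies.
\<close>

section \<open>Compact open sets of Stone spaces\<close>

lemma stone_space_compact_open_nbhd:
  assumes "stone_space W" "openin W U" "x \<in> U"
  obtains C where "compact_open_in W C" "x \<in> C" "C \<subseteq> U"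
proof -
  have "(arbitrary union_of (compact_open_in W)) U"
    using assms(1,2) by (simp add: stone_space_def)
  then obtain \<U> where "\<U> \<subseteq> Collect (compact_open_in W)" "\<Union>\<U> = U"
    by (auto simp: union_of_def)
  with assms(3) that show thesis by blast
qed

lemma compact_open_in_Un:
  "compact_open_in W A \<Longrightarrow> compact_open_in W B \<Longrightarrow> compact_open_in W (A \<union> B)"
  by (simp add: compact_open_in_def compactin_Un openin_Un)

lemma compact_open_in_Union:
  assumes "finite \<F>" "\<And>A. A \<in> \<F> \<Longrightarrow> compact_open_in W A"
  shows "compact_open_in W (\<Union>\<F>)"
  using assms
proof (induction \<F>)
  case empty
  show ?case by (simp add: compact_open_in_def)
next
  case (insert A \<F>)
  then show ?case by (simp add: compact_open_in_Un)
qed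

lemma compact_open_in_Diff:
  assumes "Hausdorff_space W" "compact_open_in W A" "compact_open_in W B"
  shows "compact_open_in W (A - B)"
proof -
  have "closedin W B" using assms by (simp add: compact_open_in_def compactin_imp_closedin)
  moreover have "A - B = (topspace W - B) \<inter> A"
    using assms(2) by (auto simp: compact_open_in_def dest: openin_subset)
  moreover have "closedin W (topspace W - B)"
    using assms(3) by (auto simp: compact_open_in_def)
  ultimately show ?thesis
    using assms(2) by (metis closed_Int_compactin compact_open_in_def openin_diff)
qed

lemma compact_open_in_Int:
  assumes "Hausdorff_space W" "compact_open_in W A" "compact_open_in W B"
  shows "compact_open_in W (A \<inter> B)"
  using compact_open_in_Diff[OF assms(1,2) compact_open_in_Diff[OF assms]]
  by (simp add: Diff_Diff_Int)

lemma nested_compactin_Inter_nonempty: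
  fixes C :: "nat \<Rightarrow> 'a set"
  assumes "Hausdorff_space W" "\<And>n. compactin W (C n)" "\<And>n. C n \<noteq> {}"
    and "\<And>n. C (Suc n) \<subseteq> C n"
  shows "(\<Inter>n. C n) \<noteq> {}"
proof -
  have dec: "decseq C" using assms(4) by (simp add: decseq_Suc_iff)
  have "closedin (subtopology W (C 0)) (C n)" for n
    using assms(1,2) decseqD[OF dec, of 0 n]
    by (simp add: closedin_subset_topspace compactin_imp_closedin)
  then show ?thesis
    using compact_space_imp_nest[of "subtopology W (C 0)" C] assms(2,3) dec
    by (simp add: compact_space_subtopology)
qed


section \<open>Trim sets\<close>

locale trim_partitioned_stone_space =
  fixes W :: "'a topology" and P :: "'p set" and ltP :: "'p \<Rightarrow> 'p \<Rightarrow> bool"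
    and Z :: "'p \<Rightarrow> 'a set"
  assumes stone: "stone_space W" and po: "po_system P ltP" and trim: "trim_partition W P ltP Z"
begin

lemma hausdorff: "Hausdorff_space W"
  using stone by (simp add: stone_space_def)

lemma le_antisym: "p \<in> P \<Longrightarrow> q \<in> P \<Longrightarrow> po_le ltP p q \<Longrightarrow> po_le ltP q p \<Longrightarrow> p = q"
  using po by (auto simp: po_system_def po_le_def antisymp_on_def)

lemma le_trans:
  "p \<in> P \<Longrightarrow> q \<in> P \<Longrightarrow> r \<in> P \<Longrightarrow> po_le ltP p q \<Longrightarrow> po_le ltP q r \<Longrightarrow> po_le ltP p r"
  using po unfolding po_system_def po_le_def transp_on_def by blast

lemma Z_nonempty: "p \<in> P \<Longrightarrow> Z p \<noteq> {}"
  and Z_subset: "p \<in> P \<Longrightarrow> Z p \<subseteq> topspace W"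
  and Z_disjoint: "p \<in> P \<Longrightarrow> q \<in> P \<Longrightarrow> x \<in> Z p \<Longrightarrow> x \<in> Z q \<Longrightarrow> p = q"
  using trim unfolding trim_partition_def po_partition_def disjoint_family_on_def by blast+

lemma derived_set_Z:
  assumes "p \<in> P" "q \<in> P" "x \<in> Z p"
  shows "x \<in> W derived_set_of (Z q) \<longleftrightarrow> ltP p q"
proof -
  have "W derived_set_of (Z q) \<inter> (\<Union>r\<in>P. Z r) = (\<Union>r\<in>{r \<in> P. ltP r q}. Z r)"
    using trim assms(2) by (auto simp: trim_partition_def po_partition_def)
  with assms show ?thesis using Z_disjoint by blast
qed

lemma open_meets_above:
  assumes "openin W U" "x \<in> U" "x \<in> Z p" "p \<in> P" "q \<in> P" "ltP p q"
  obtains y where "y \<in> U" "y \<in> Z q" "y \<noteq> x"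
  using derived_set_Z[of p q x] assms by (auto simp: in_derived_set_of)

text \<open>Types of open sets are upwards closed, because \<open>Z p\<close> lies in the closure of \<open>Z q\<close> for
  \<open>p < q\<close>; so membership of the type can be tested at its least element alone.\<close>

lemma Trim_iff:
  assumes "p \<in> P"
  shows "A \<in> Trim W P ltP Z p \<longleftrightarrow>
    compact_open_in W A \<and> A \<inter> Z p \<noteq> {} \<and> (\<forall>q\<in>P. A \<inter> Z q \<noteq> {} \<longrightarrow> po_le ltP p q) \<and>
    (\<not> ltP p p \<longrightarrow> (\<forall>x y. x \<in> A \<inter> Z p \<longrightarrow> y \<in> A \<inter> Z p \<longrightarrow> x = y))"
    (is "?L \<longleftrightarrow> ?R")
proof
  assume ?L
  then have co: "compact_open_in W A" and ty: "type_of_set P Z A = up_set P ltP {p}"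
    and card: "\<not> ltP p p \<Longrightarrow> card (A \<inter> Z p) = 1"
    using assms by (auto simp: Trim_def po_discrete_def)
  have "p \<in> type_of_set P Z A"
    unfolding ty using assms by (simp add: up_set_def po_le_def)
  moreover have "po_le ltP p q" if "q \<in> P" "A \<inter> Z q \<noteq> {}" for q
  proof -
    have "q \<in> type_of_set P Z A" using that by (simp add: type_of_set_def)
    then show ?thesis unfolding ty by (simp add: up_set_def)
  qed
  moreover have "x = y" if "\<not> ltP p p" "x \<in> A \<inter> Z p" "y \<in> A \<inter> Z p" for x y
    using card[OF that(1)] that(2,3) by (metis card_1_singletonE singletonD)
  ultimately show ?R using co by (auto simp: type_of_set_def)
next
  assume R: ?R
  then obtain x where x: "x \<in> A" "x \<in> Z p" by blast
  have "A \<inter> Z q \<noteq> {}" if q: "q \<in> P" "po_le ltP p q" for q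
  proof (cases "p = q")
    case True then show ?thesis using x by blast
  next
    case False
    then have "ltP p q" using q by (auto simp: po_le_def)
    then show ?thesis
      using open_meets_above[of A x p q] R x assms q by (auto simp: compact_open_in_def)
  qed
  then have "type_of_set P Z A = up_set P ltP {p}"
    using R by (auto simp: type_of_set_def up_set_def)
  moreover have "card (A \<inter> Z p) = 1" if "\<not> ltP p p"
  proof -
    have "A \<inter> Z p = {x}" using R that x by blast
    then show ?thesis by simp
  qed
  ultimately show ?L using R by (auto simp: Trim_def po_discrete_def)
qed

lemma Trim_compact_open: "A \<in> Trim W P ltP Z p \<Longrightarrow> compact_open_in W A"
  by (simp add: Trim_def)

lemma Trim_openin: "A \<in> Trim W P ltP Z p \<Longrightarrow> openin W A"
  by (simp add: Trim_def compact_open_in_def)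

lemma Trim_nonempty: "p \<in> P \<Longrightarrow> A \<in> Trim W P ltP Z p \<Longrightarrow> A \<noteq> {}"
  by (auto simp: Trim_iff)

lemma Trim_subset:
  assumes "p \<in> P" "A \<in> Trim W P ltP Z p" "compact_open_in W B" "B \<subseteq> A" "B \<inter> Z p \<noteq> {}"
  shows "B \<in> Trim W P ltP Z p"
  using assms by (simp add: Trim_iff) blast

lemma Trim_Un:
  assumes "p \<in> P" "A \<in> Trim W P ltP Z p" "compact_open_in W B"
    and "\<And>q. q \<in> P \<Longrightarrow> B \<inter> Z q \<noteq> {} \<Longrightarrow> ltP p q"
  shows "A \<union> B \<in> Trim W P ltP Z p"
proof -
  have "\<not> ltP p p \<longrightarrow> B \<inter> Z p = {}" using assms(1,4) by blast
  then show ?thesis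
    using assms by (auto simp: Trim_iff Int_Un_distrib2 po_le_def compact_open_in_Un)
qed

lemma trim_nbhd:
  assumes "openin W U" "x \<in> U" "x \<in> Z p" "p \<in> P"
  obtains A where "A \<in> Trim W P ltP Z p" "x \<in> A" "A \<subseteq> U"
proof -
  obtain A where A: "A \<in> Trim W P ltP Z p" "x \<in> A"
    using trim assms by (auto simp: trim_partition_def trim_T3_def)
  have "openin W (A \<inter> U)" using A assms Trim_openin by blast
  then obtain C where C: "compact_open_in W C" "x \<in> C" "C \<subseteq> A \<inter> U"
    using stone_space_compact_open_nbhd[OF stone] A assms by (metis IntI)
  then have "C \<in> Trim W P ltP Z p"
    using Trim_subset[of p A C] A assms by blast
  with C that show thesis by blast
qed

lemma trim_base:
  assumes "openin W U" "x \<in> U"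
  obtains A p where "p \<in> P" "A \<in> Trim W P ltP Z p" "x \<in> A" "A \<subseteq> U"
proof -
  have "x \<in> topspace W" using assms openin_subset by blast
  then show thesis
    using trim assms that unfolding trim_partition_def trim_T1_def neighbourhood_base_at_def
    by (metis subsetD)
qed

text \<open>Overlaps of two trim sets are removed by absorption. If \<open>T\<close> is \<open>p\<close>-trim and is added to a
  disjoint family with union \<open>D\<close>, then either \<open>T - D\<close> still meets \<open>Z p\<close> and is \<open>p\<close>-trim
  itself, or a member \<open>A\<close> of the family contains a point of \<open>Z p\<close>. In the latter case the
  label of \<open>A\<close> is at most \<open>p\<close>, and \<open>T - D\<close> can be absorbed into \<open>A\<close>.\<close>

lemma finite_Union_trim_disjoint:
  assumes "finite \<T>" "\<And>T. T \<in> \<T> \<Longrightarrow> \<exists>p\<in>P. T \<in> Trim W P ltP Z p"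
  shows "\<exists>\<F>. finite \<F> \<and> (\<forall>T\<in>\<F>. \<exists>p\<in>P. T \<in> Trim W P ltP Z p) \<and> disjoint \<F> \<and> \<Union>\<F> = \<Union>\<T>"
  using assms
proof (induction \<T>)
  case empty
  show ?case by (rule exI[of _ "{}"]) simp
next
  case (insert T \<T>)
  then obtain \<F> where \<F>: "finite \<F>" "\<forall>T\<in>\<F>. \<exists>p\<in>P. T \<in> Trim W P ltP Z p" "disjoint \<F>"
    "\<Union>\<F> = \<Union>\<T>"
    by (metis insertCI)
  obtain p where p: "p \<in> P" "T \<in> Trim W P ltP Z p" using insert.prems by blast
  let ?R = "T - \<Union>\<F>"
  have "compact_open_in W (\<Union>\<F>)"
    using \<F>(1,2) Trim_compact_open by (blast intro: compact_open_in_Union)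
  then have co: "compact_open_in W ?R"
    using p Trim_compact_open hausdorff compact_open_in_Diff by blast
  show ?case
  proof (cases "?R \<inter> Z p = {}")
    case False
    then have "?R \<in> Trim W P ltP Z p" using Trim_subset p co by blast
    moreover have "disjoint (insert ?R \<F>)" using \<F>(3) by (auto simp: pairwise_insert disjnt_def)
    ultimately show ?thesis
      using \<F> p by (intro exI[of _ "insert ?R \<F>"]) auto
  next
    case True
    obtain x where x: "x \<in> T" "x \<in> Z p" using p by (auto simp: Trim_iff)
    with True obtain A where A: "A \<in> \<F>" "x \<in> A" by blast
    then obtain r where r: "r \<in> P" "A \<in> Trim W P ltP Z r" using \<F>(2) by blast
    have rp: "po_le ltP r p" using r A(2) x p(1) by (auto simp: Trim_iff)
    have "ltP r q" if q: "q \<in> P" "?R \<inter> Z q \<noteq> {}" for q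
    proof -
      have pq: "po_le ltP p q" using q p by (auto simp: Trim_iff)
      moreover have "p \<noteq> q" using True q by blast
      ultimately have "r \<noteq> q" using rp le_antisym p r by blast
      moreover have "po_le ltP r q" using le_trans[OF r(1) p(1) q(1) rp pq] .
      ultimately show ?thesis by (simp add: po_le_def)
    qed
    then have "A \<union> ?R \<in> Trim W P ltP Z r" using Trim_Un r co by blast
    moreover have "disjoint (insert (A \<union> ?R) (\<F> - {A}))"
      using \<F>(3) A(1) by (auto simp: pairwise_insert disjnt_def pairwise_def)
    moreover have "\<Union>(insert (A \<union> ?R) (\<F> - {A})) = \<Union>(insert T \<T>)"
      using \<F>(4) A(1) by auto
    ultimately show ?thesis
      using \<F>(1,2) r(1) by (intro exI[of _ "insert (A \<union> ?R) (\<F> - {A})"]) auto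
  qed
qed

lemma compact_open_disjoint_trims:
  assumes "compact_open_in W C"
  obtains \<F> where "finite \<F>" "\<And>T. T \<in> \<F> \<Longrightarrow> \<exists>p\<in>P. T \<in> Trim W P ltP Z p"
    "disjoint \<F>" "\<Union>\<F> = C"
proof -
  let ?\<U> = "{T. T \<subseteq> C \<and> (\<exists>p\<in>P. T \<in> Trim W P ltP Z p)}"
  have "C \<subseteq> \<Union>?\<U>"
  proof
    fix x assume "x \<in> C"
    then obtain A p where "p \<in> P" "A \<in> Trim W P ltP Z p" "x \<in> A" "A \<subseteq> C"
      using trim_base assms by (metis compact_open_in_def)
    then show "x \<in> \<Union>?\<U>" by blast
  qed
  moreover have "compactin W C" "\<And>U. U \<in> ?\<U> \<Longrightarrow> openin W U"
    using assms Trim_openin by (auto simp: compact_open_in_def)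
  ultimately obtain \<T> where \<T>: "finite \<T>" "\<T> \<subseteq> ?\<U>" "C \<subseteq> \<Union>\<T>"
    using compactinD[of W C ?\<U>] by blast
  then have "\<Union>\<T> = C" by blast
  moreover have "\<exists>p\<in>P. T \<in> Trim W P ltP Z p" if "T \<in> \<T>" for T using that \<T>(2) by blast
  ultimately show thesis
    using finite_Union_trim_disjoint[OF \<T>(1)] that by metis
qed

end


section \<open>Families of trim sets labelled by \<open>Q\<close>\<close>

locale trim_labelling = trim_partitioned_stone_space W P ltP Z
  for W :: "'a topology" and P :: "'p set" and ltP :: "'p \<Rightarrow> 'p \<Rightarrow> bool"
    and Z :: "'p \<Rightarrow> 'a set" +
  fixes Q :: "'q set" and ltQ :: "'q \<Rightarrow> 'q \<Rightarrow> bool" and \<alpha> :: "'q \<Rightarrow> 'p"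
  assumes poQ: "po_system Q ltQ" and morphism: "po_morphism Q ltQ P ltP \<alpha>"
    and surjective: "\<alpha> ` Q = P"
begin

definition labelled_family :: "('a set \<times> 'q) set \<Rightarrow> bool" where
  "labelled_family D \<longleftrightarrow> finite D \<and>
     (\<forall>A q. (A, q) \<in> D \<longrightarrow> q \<in> Q \<and> A \<in> Trim W P ltP Z (\<alpha> q)) \<and>
     (\<forall>A q B r. (A, q) \<in> D \<longrightarrow> (B, r) \<in> D \<longrightarrow> A \<inter> B \<noteq> {} \<longrightarrow> A = B \<and> q = r)"

definition carrier_of :: "('a set \<times> 'q) set \<Rightarrow> 'a set" where
  "carrier_of D = \<Union>(fst ` D)"

text \<open>In the partition to be built, a set labelled \<open>q\<close> is going to be \<open>q\<close>-trim. Hence labels may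
  only increase under refinement, \<open>q\<close> has to survive inside the set, and if \<open>q\<close> is discrete
  then only one piece may inherit it, since a \<open>q\<close>-trim set then has a single point of type
  \<open>q\<close>.\<close>

definition refines_family :: "('a set \<times> 'q) set \<Rightarrow> ('a set \<times> 'q) set \<Rightarrow> bool" where
  "refines_family D' D \<longleftrightarrow> carrier_of D \<subseteq> carrier_of D' \<and>
     (\<forall>A q. (A, q) \<in> D \<longrightarrow>
        (\<forall>B r. (B, r) \<in> D' \<longrightarrow> A \<inter> B \<noteq> {} \<longrightarrow> B \<subseteq> A \<and> po_le ltQ q r) \<and>
        (\<exists>B. (B, q) \<in> D' \<and> B \<subseteq> A) \<and>
        (\<not> ltQ q q \<longrightarrow>
           (\<forall>B C. (B, q) \<in> D' \<longrightarrow> (C, q) \<in> D' \<longrightarrow> B \<subseteq> A \<longrightarrow> C \<subseteq> A \<longrightarrow> B = C)))"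

lemma carrier_of_simps [simp]:
  "carrier_of {} = {}"
  "carrier_of (insert (A, q) D) = A \<union> carrier_of D"
  "carrier_of (D \<union> E) = carrier_of D \<union> carrier_of E"
  by (auto simp: carrier_of_def)

lemma carrier_ofE:
  assumes "x \<in> carrier_of D"
  obtains A q where "(A, q) \<in> D" "x \<in> A"
  using assms by (auto simp: carrier_of_def)

lemma subset_carrier_of: "(A, q) \<in> D \<Longrightarrow> A \<subseteq> carrier_of D"
  by (force simp: carrier_of_def)

lemma leQ_antisym: "q \<in> Q \<Longrightarrow> r \<in> Q \<Longrightarrow> po_le ltQ q r \<Longrightarrow> po_le ltQ r q \<Longrightarrow> q = r"
  using poQ by (auto simp: po_system_def po_le_def antisymp_on_def)

lemma leQ_trans:
  "q \<in> Q \<Longrightarrow> r \<in> Q \<Longrightarrow> s \<in> Q \<Longrightarrow> po_le ltQ q r \<Longrightarrow> po_le ltQ r s \<Longrightarrow> po_le ltQ q s"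
  using poQ unfolding po_system_def po_le_def transp_on_def by blast

lemma \<alpha>_in_P: "q \<in> Q \<Longrightarrow> \<alpha> q \<in> P"
  using surjective by blast

lemma morphism_less: "q \<in> Q \<Longrightarrow> r \<in> Q \<Longrightarrow> ltQ q r \<Longrightarrow> ltP (\<alpha> q) (\<alpha> r)"
  using morphism unfolding po_morphism_def by blast

lemma morphism_lift:
  assumes "q \<in> Q" "p \<in> P" "ltP (\<alpha> q) p"
  obtains r where "r \<in> Q" "ltQ q r" "\<alpha> r = p"
proof -
  have "p \<in> \<alpha> ` {r \<in> Q. ltQ q r}" using assms morphism by (simp add: po_morphism_def)
  then show thesis using that by blast
qed

lemma labelled_familyD:
  assumes "labelled_family D" "(A, q) \<in> D"
  shows "q \<in> Q" "A \<in> Trim W P ltP Z (\<alpha> q)" "A \<noteq> {}" "A \<subseteq> carrier_of D"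
    "compact_open_in W A" "openin W A"
proof -
  show *: "q \<in> Q" "A \<in> Trim W P ltP Z (\<alpha> q)" using assms by (auto simp: labelled_family_def)
  then show "A \<noteq> {}" "compact_open_in W A" "openin W A"
    using Trim_nonempty[OF \<alpha>_in_P] Trim_compact_open Trim_openin by blast+
  show "A \<subseteq> carrier_of D" using assms(2) by (rule subset_carrier_of)
qed

lemma labelled_family_overlap:
  "labelled_family D \<Longrightarrow> (A, q) \<in> D \<Longrightarrow> (B, r) \<in> D \<Longrightarrow> A \<inter> B \<noteq> {} \<Longrightarrow> A = B \<and> q = r"
  unfolding labelled_family_def by blast

lemma carrier_of_compact_open:
  assumes "labelled_family D"
  shows "compact_open_in W (carrier_of D)"
  unfolding carrier_of_def
proof (rule compact_open_in_Union)
  show "finite (fst ` D)" using assms by (simp add: labelled_family_def)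
  show "\<And>A. A \<in> fst ` D \<Longrightarrow> compact_open_in W A" using labelled_familyD(5)[OF assms] by force
qed

lemma labelled_family_singleton:
  "q \<in> Q \<Longrightarrow> A \<in> Trim W P ltP Z (\<alpha> q) \<Longrightarrow> labelled_family {(A, q)}"
  by (auto simp: labelled_family_def)

lemma labelled_family_image:
  assumes "finite \<F>" "disjoint \<F>"
    and l: "\<And>T. T \<in> \<F> \<Longrightarrow> l T \<in> Q \<and> T \<in> Trim W P ltP Z (\<alpha> (l T))"
  shows "labelled_family ((\<lambda>T. (T, l T)) ` \<F>)" "carrier_of ((\<lambda>T. (T, l T)) ` \<F>) = \<Union>\<F>"
proof -
  have "S = T" if "S \<in> \<F>" "T \<in> \<F>" "S \<inter> T \<noteq> {}" for S T
    using assms(2) that unfolding disjoint_def by blast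
  then show "labelled_family ((\<lambda>T. (T, l T)) ` \<F>)"
    using assms(1) l unfolding labelled_family_def by auto
  show "carrier_of ((\<lambda>T. (T, l T)) ` \<F>) = \<Union>\<F>" by (simp add: carrier_of_def image_image)
qed

lemma labelled_family_Un:
  assumes "labelled_family D" "labelled_family E" "carrier_of D \<inter> carrier_of E = {}"
  shows "labelled_family (D \<union> E)"
  unfolding labelled_family_def
proof (intro conjI allI impI)
  show "finite (D \<union> E)" using assms by (simp add: labelled_family_def)
next
  fix A q assume "(A, q) \<in> D \<union> E"
  then show "q \<in> Q" "A \<in> Trim W P ltP Z (\<alpha> q)"
    using assms(1,2) labelled_familyD by auto
next
  fix A q B r assume AB: "(A, q) \<in> D \<union> E" "(B, r) \<in> D \<union> E" "A \<inter> B \<noteq> {}"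
  have "A \<inter> B = {}" if "(A, q) \<in> D \<and> (B, r) \<in> E \<or> (A, q) \<in> E \<and> (B, r) \<in> D"
    using that subset_carrier_of[of A q D] subset_carrier_of[of B r E]
      subset_carrier_of[of A q E] subset_carrier_of[of B r D] assms(3) by blast
  then consider "(A, q) \<in> D" "(B, r) \<in> D" | "(A, q) \<in> E" "(B, r) \<in> E"
    using AB by auto
  then have "A = B \<and> q = r"
    by cases (use labelled_family_overlap[OF assms(1) _ _ AB(3)]
        labelled_family_overlap[OF assms(2) _ _ AB(3)] in simp_all)
  then show "A = B" "q = r" by auto
qed

lemma refines_familyD:
  assumes "refines_family D' D" "(A, q) \<in> D"
  shows "\<And>B r. (B, r) \<in> D' \<Longrightarrow> A \<inter> B \<noteq> {} \<Longrightarrow> B \<subseteq> A"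
    and "\<And>B r. (B, r) \<in> D' \<Longrightarrow> A \<inter> B \<noteq> {} \<Longrightarrow> po_le ltQ q r"
    and "\<exists>B. (B, q) \<in> D' \<and> B \<subseteq> A"
    and "\<And>B C. \<not> ltQ q q \<Longrightarrow> (B, q) \<in> D' \<Longrightarrow> (C, q) \<in> D' \<Longrightarrow> B \<subseteq> A \<Longrightarrow> C \<subseteq> A \<Longrightarrow> B = C"
proof -
  note * = conjunct2[OF assms(1)[unfolded refines_family_def], rule_format, OF assms(2)]
  show "\<And>B r. (B, r) \<in> D' \<Longrightarrow> A \<inter> B \<noteq> {} \<Longrightarrow> B \<subseteq> A"
    and "\<And>B r. (B, r) \<in> D' \<Longrightarrow> A \<inter> B \<noteq> {} \<Longrightarrow> po_le ltQ q r"
    and "\<exists>B. (B, q) \<in> D' \<and> B \<subseteq> A"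
    and "\<And>B C. \<not> ltQ q q \<Longrightarrow> (B, q) \<in> D' \<Longrightarrow> (C, q) \<in> D' \<Longrightarrow> B \<subseteq> A \<Longrightarrow> C \<subseteq> A \<Longrightarrow> B = C"
    using * by simp_all
qed

lemma refines_family_carrier: "refines_family D' D \<Longrightarrow> carrier_of D \<subseteq> carrier_of D'"
  by (simp add: refines_family_def)

lemma refines_family_refl:
  assumes "labelled_family D"
  shows "refines_family D D"
  unfolding refines_family_def
proof (intro conjI allI impI)
  fix A q assume A: "(A, q) \<in> D"
  show "\<exists>B. (B, q) \<in> D \<and> B \<subseteq> A" using A by blast
  fix B r assume B: "(B, r) \<in> D"
  { assume "A \<inter> B \<noteq> {}"
    then show "B \<subseteq> A" "po_le ltQ q r"
      using labelled_family_overlap[OF assms A B] by (auto simp: po_le_def) }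
next
  fix A q B C assume A: "(A, q) \<in> D" and B: "(B, q) \<in> D" "(C, q) \<in> D" "B \<subseteq> A" "C \<subseteq> A"
  then have "A \<inter> B \<noteq> {}" "A \<inter> C \<noteq> {}" using labelled_familyD(3)[OF assms] by blast+
  then show "B = C" using labelled_family_overlap[OF assms A] B by blast
qed simp

lemma refines_family_trans:
  assumes l: "labelled_family D" "labelled_family D'" "labelled_family D''"
    and r1: "refines_family D' D" and r2: "refines_family D'' D'"
  shows "refines_family D'' D"
proof -
  \<comment> \<open>A piece of \<open>D''\<close> that meets a member of \<open>D\<close> passes through a member of \<open>D'\<close>.\<close>
  have step: "\<exists>B r. (B, r) \<in> D' \<and> C \<subseteq> B \<and> B \<subseteq> A \<and> po_le ltQ q r \<and> po_le ltQ r s"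
    if A: "(A, q) \<in> D" and C: "(C, s) \<in> D''" and AC: "A \<inter> C \<noteq> {}" for A q C s
  proof -
    obtain x where x: "x \<in> A" "x \<in> C" using AC by blast
    then have "x \<in> carrier_of D'"
      using refines_family_carrier[OF r1] labelled_familyD(4)[OF l(1) A] by blast
    then obtain B r where B: "(B, r) \<in> D'" "x \<in> B" by (rule carrier_ofE)
    then have "B \<subseteq> A" "po_le ltQ q r"
      using refines_familyD(1,2)[OF r1 A B(1)] x by blast+
    moreover have "C \<subseteq> B" "po_le ltQ r s"
      using refines_familyD(1,2)[OF r2 B(1) C] x B by blast+
    ultimately show ?thesis using B by blast
  qed
  show ?thesis
    unfolding refines_family_def
  proof (intro conjI allI impI)
    show "carrier_of D \<subseteq> carrier_of D''"
      using refines_family_carrier[OF r1] refines_family_carrier[OF r2] by (rule subset_trans)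
  next
    fix A q assume A: "(A, q) \<in> D"
    obtain B where B: "(B, q) \<in> D'" "B \<subseteq> A" using refines_familyD(3)[OF r1 A] by blast
    obtain C where "(C, q) \<in> D''" "C \<subseteq> B" using refines_familyD(3)[OF r2 B(1)] by blast
    then show "\<exists>C. (C, q) \<in> D'' \<and> C \<subseteq> A" using B by blast
  next
    fix A q C s assume A: "(A, q) \<in> D" and C: "(C, s) \<in> D''" and AC: "A \<inter> C \<noteq> {}"
    obtain B r where B: "(B, r) \<in> D'" "C \<subseteq> B" "B \<subseteq> A" "po_le ltQ q r" "po_le ltQ r s"
      using step[OF A C AC] by blast
    show "C \<subseteq> A" using B by blast
    have "q \<in> Q" "r \<in> Q" "s \<in> Q"
      using labelled_familyD(1)[OF l(1) A] labelled_familyD(1)[OF l(2) B(1)]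
        labelled_familyD(1)[OF l(3) C] by auto
    then show "po_le ltQ q s" using leQ_trans B(4,5) by blast
  next
    fix A q C C'
    assume A: "(A, q) \<in> D" and q: "\<not> ltQ q q"
      and C: "(C, q) \<in> D''" "C \<subseteq> A" and C': "(C', q) \<in> D''" "C' \<subseteq> A"
    have *: "\<exists>B. (B, q) \<in> D' \<and> C \<subseteq> B \<and> B \<subseteq> A" if C: "(C, q) \<in> D''" "C \<subseteq> A" for C
    proof -
      have "A \<inter> C \<noteq> {}" using labelled_familyD(3)[OF l(3) C(1)] C(2) by blast
      then obtain B r where B: "(B, r) \<in> D'" "C \<subseteq> B" "B \<subseteq> A" "po_le ltQ q r" "po_le ltQ r q"
        using step[OF A C(1)] by blast
      have "q = r"
        using leQ_antisym B labelled_familyD(1)[OF l(2) B(1)] labelled_familyD(1)[OF l(1) A] by blast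
      then show ?thesis using B by blast
    qed
    obtain B B' where B: "(B, q) \<in> D'" "C \<subseteq> B" "B \<subseteq> A" and B': "(B', q) \<in> D'" "C' \<subseteq> B'" "B' \<subseteq> A"
      using *[OF C] *[OF C'] by blast
    have "B = B'" using refines_familyD(4)[OF r1 A q B(1) B'(1)] B B' by blast
    then show "C = C'" using refines_familyD(4)[OF r2 B(1) q C(1) C'(1)] B B' by blast
  qed
qed

definition subdivides :: "('a set \<times> 'q) set \<Rightarrow> 'a set \<Rightarrow> 'q \<Rightarrow> bool" where
  "subdivides E A q \<longleftrightarrow> labelled_family E \<and> refines_family E {(A, q)} \<and> carrier_of E = A"

text \<open>Since the members of a labelled family are disjoint, they can be subdivided independently
  of each other, and new members can be added outside.\<close>

lemma refine_memberwise:
  assumes D: "labelled_family D" and E: "\<And>A q. (A, q) \<in> D \<Longrightarrow> subdivides (E A q) A q"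
    and G: "labelled_family G" "carrier_of D \<inter> carrier_of G = {}"
  defines "D' \<equiv> (\<Union>(A, q)\<in>D. E A q) \<union> G"
  shows "labelled_family D'" "refines_family D' D"
proof -
  let ?E = "\<Union>(A, q)\<in>D. E A q"
  have El: "labelled_family (E A q)" and Er: "refines_family (E A q) {(A, q)}"
    and Ec: "carrier_of (E A q) = A" if "(A, q) \<in> D" for A q
    using E[OF that] by (auto simp: subdivides_def)
  have sub: "B \<subseteq> A" if "(A, q) \<in> D" "(B, r) \<in> E A q" for A q B r
    using labelled_familyD(4)[OF El[OF that(1)] that(2)] Ec[OF that(1)] by simp
  have car: "carrier_of ?E = carrier_of D"
  proof
    show "carrier_of ?E \<subseteq> carrier_of D"
    proof
      fix x assume "x \<in> carrier_of ?E"
      then obtain B r where B: "(B, r) \<in> ?E" "x \<in> B" by (rule carrier_ofE)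
      then obtain A q where A: "(A, q) \<in> D" "(B, r) \<in> E A q" by blast
      then show "x \<in> carrier_of D" using sub[OF A] subset_carrier_of[OF A(1)] B(2) by blast
    qed
    show "carrier_of D \<subseteq> carrier_of ?E"
    proof
      fix x assume "x \<in> carrier_of D"
      then obtain A q where A: "(A, q) \<in> D" "x \<in> A" by (rule carrier_ofE)
      then have "x \<in> carrier_of (E A q)" using Ec[OF A(1)] by simp
      then obtain B r where B: "(B, r) \<in> E A q" "x \<in> B" by (rule carrier_ofE)
      then have "(B, r) \<in> ?E" using A(1) by blast
      then show "x \<in> carrier_of ?E" using subset_carrier_of[of B r ?E] B(2) by blast
    qed
  qed
  \<comment> \<open>A piece that meets \<open>A\<close> is one of the pieces of \<open>A\<close>.\<close>
  have own: "(B, r) \<in> E A q" if A: "(A, q) \<in> D" and B: "(B, r) \<in> D'" and AB: "A \<inter> B \<noteq> {}" for A q B r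
  proof -
    have "(B, r) \<notin> G"
      using AB subset_carrier_of[of B r G] subset_carrier_of[OF A] G(2) by blast
    then obtain A' q' where A': "(A', q') \<in> D" "(B, r) \<in> E A' q'"
      using B by (auto simp: D'_def)
    then have "A \<inter> A' \<noteq> {}" using sub[OF A'] AB by blast
    then show ?thesis using labelled_family_overlap[OF D A A'(1)] A' by blast
  qed
  have "labelled_family ?E"
    unfolding labelled_family_def
  proof (intro conjI allI impI)
    show "finite ?E" using D El by (auto simp: labelled_family_def)
  next
    fix B r assume "(B, r) \<in> ?E"
    then obtain A q where A: "(A, q) \<in> D" "(B, r) \<in> E A q" by blast
    show "r \<in> Q" "B \<in> Trim W P ltP Z (\<alpha> r)"
      using labelled_familyD(1,2)[OF El[OF A(1)] A(2)] by auto
  next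
    fix B r C s assume B: "(B, r) \<in> ?E" and C: "(C, s) \<in> ?E" and BC: "B \<inter> C \<noteq> {}"
    obtain A q where A: "(A, q) \<in> D" "(B, r) \<in> E A q" using B by auto
    have "(C, s) \<in> E A q" using own[OF A(1), of C s] C sub[OF A] BC by (auto simp: D'_def)
    then show "B = C" "r = s" using labelled_family_overlap[OF El[OF A(1)] A(2) _ BC] by auto
  qed
  then show l: "labelled_family D'"
    unfolding D'_def using G car by (intro labelled_family_Un) auto
  show "refines_family D' D"
    unfolding refines_family_def
  proof (intro conjI allI impI)
    show "carrier_of D \<subseteq> carrier_of D'" using car by (simp add: D'_def)
  next
    fix A q assume A: "(A, q) \<in> D"
    obtain B where B: "(B, q) \<in> E A q" "B \<subseteq> A"
      using refines_familyD(3)[OF Er[OF A], of A q] by auto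
    then have "(B, q) \<in> D'" using A by (auto simp: D'_def)
    with B(2) show "\<exists>B. (B, q) \<in> D' \<and> B \<subseteq> A" by blast
  next
    fix A q B r assume A: "(A, q) \<in> D" and B: "(B, r) \<in> D'" and AB: "A \<inter> B \<noteq> {}"
    show "B \<subseteq> A" "po_le ltQ q r"
      using refines_familyD(1,2)[OF Er[OF A] _ own[OF A B AB] AB] by auto
  next
    fix A q B C
    assume A: "(A, q) \<in> D" and q: "\<not> ltQ q q"
      and B: "(B, q) \<in> D'" "B \<subseteq> A" and C: "(C, q) \<in> D'" "C \<subseteq> A"
    have "(B, q) \<in> E A q" "(C, q) \<in> E A q"
      using own[OF A B(1)] own[OF A C(1)] labelled_familyD(3)[OF l] B C by blast+
    then show "B = C" using refines_familyD(4)[OF Er[OF A] _ q] B(2) C(2) by blast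
  qed
qed

lemma subdivides_self:
  "q \<in> Q \<Longrightarrow> A \<in> Trim W P ltP Z (\<alpha> q) \<Longrightarrow> subdivides {(A, q)} A q"
  by (simp add: subdivides_def labelled_family_singleton refines_family_refl)

lemma subdividesI:
  assumes "labelled_family E" "carrier_of E = A"
    and "(B, q) \<in> E" "\<And>C r. (C, r) \<in> E \<Longrightarrow> C \<noteq> B \<Longrightarrow> ltQ q r"
  shows "subdivides E A q"
proof -
  have eq: "r = q" if "(B, r) \<in> E" for r
    using labelled_family_overlap[OF assms(1) that assms(3)] labelled_familyD(3)[OF assms(1,3)] by blast
  have "refines_family E {(A, q)}"
    unfolding refines_family_def
  proof (intro conjI allI impI)
    fix A' q' assume "(A', q') \<in> {(A, q)}"
    then have [simp]: "A' = A" "q' = q" by auto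
    show "\<exists>B. (B, q') \<in> E \<and> B \<subseteq> A'" using assms(3) subset_carrier_of[OF assms(3)] assms(2) by auto
    { fix C r assume "(C, r) \<in> E"
      then show "C \<subseteq> A'" "po_le ltQ q' r"
        using assms(2,4) eq subset_carrier_of[of C r E] by (auto simp: po_le_def) }
    { fix C C' assume "\<not> ltQ q' q'" "(C, q') \<in> E" "(C', q') \<in> E"
      then show "C = C'" using assms(4) by auto }
  qed (use assms(2) in auto)
  then show ?thesis using assms(1,2) by (simp add: subdivides_def)
qed

text \<open>Labelling a decomposition of a \<open>q\<close>-labelled set. One trim piece that contains a point of
  \<open>Z (\<alpha> q)\<close> keeps the label \<open>q\<close>. The label in \<open>P\<close> of each other piece is strictly above
  \<open>\<alpha> q\<close>, so that it lifts to a label strictly above \<open>q\<close>; it could only equal \<open>\<alpha> q\<close> if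
  \<open>\<alpha> q < \<alpha> q\<close>, because otherwise \<open>A\<close> has a single point in \<open>Z (\<alpha> q)\<close>.\<close>

lemma label_decomposition:
  assumes q: "q \<in> Q" and A: "A \<in> Trim W P ltP Z (\<alpha> q)"
    and \<F>: "finite \<F>" "\<And>T. T \<in> \<F> \<Longrightarrow> \<exists>p\<in>P. T \<in> Trim W P ltP Z p" "disjoint \<F>" "\<Union>\<F> = A"
  obtains E where "subdivides E A q" "fst ` E = \<F>"
proof -
  note p = \<alpha>_in_P[OF q]
  obtain x where x: "x \<in> A" "x \<in> Z (\<alpha> q)" using A p by (auto simp: Trim_iff)
  then obtain B where B: "B \<in> \<F>" "x \<in> B" using \<F>(4) by blast
  have "compact_open_in W B" using \<F>(2)[OF B(1)] Trim_compact_open by blast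
  then have BT: "B \<in> Trim W P ltP Z (\<alpha> q)"
    using Trim_subset[OF p A] B x \<F>(4) by blast
  have "\<exists>r\<in>Q. ltQ q r \<and> T \<in> Trim W P ltP Z (\<alpha> r)" if T: "T \<in> \<F>" "T \<noteq> B" for T
  proof -
    obtain t where t: "t \<in> P" "T \<in> Trim W P ltP Z t" using \<F>(2) T by blast
    then obtain y where y: "y \<in> T" "y \<in> Z t" by (auto simp: Trim_iff)
    then have yA: "y \<in> A" using T \<F>(4) by blast
    have "T \<inter> B = {}" using \<F>(3) T B(1) by (auto simp: disjoint_def)
    then have "x \<noteq> y" using B y by blast
    then have "\<alpha> q = t \<Longrightarrow> ltP (\<alpha> q) t" using A p x y yA by (auto simp: Trim_iff)
    moreover have "po_le ltP (\<alpha> q) t" using A p t(1) y yA by (auto simp: Trim_iff)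
    ultimately have "ltP (\<alpha> q) t" by (auto simp: po_le_def)
    then show ?thesis using morphism_lift[OF q t(1)] t(2) by metis
  qed
  then obtain r where r: "\<And>T. T \<in> \<F> \<Longrightarrow> T \<noteq> B \<Longrightarrow>
      r T \<in> Q \<and> ltQ q (r T) \<and> T \<in> Trim W P ltP Z (\<alpha> (r T))" by metis
  define l where "l T = (if T = B then q else r T)" for T
  define E where "E = (\<lambda>T. (T, l T)) ` \<F>"
  have fst: "fst ` E = \<F>" by (force simp: E_def)
  have l: "l T \<in> Q \<and> T \<in> Trim W P ltP Z (\<alpha> (l T))" if "T \<in> \<F>" for T
    using that q BT r by (simp add: l_def)
  have "labelled_family E" "carrier_of E = A"
    using labelled_family_image[of \<F> l, OF \<F>(1,3) l] \<F>(4) by (auto simp: E_def)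
  moreover have "(B, q) \<in> E" using B(1) by (force simp: E_def l_def)
  moreover have "ltQ q s" if "(C, s) \<in> E" "C \<noteq> B" for C s
  proof -
    have "C \<in> \<F>" "s = l C" using that(1) by (auto simp: E_def)
    then show ?thesis using r that(2) by (simp add: l_def)
  qed
  ultimately have "subdivides E A q" by (rule subdividesI)
  then show thesis using that fst by blast
qed

lemma subdivide_by_compact_open:
  assumes q: "q \<in> Q" and A: "A \<in> Trim W P ltP Z (\<alpha> q)" and C: "compact_open_in W C"
  obtains E where "subdivides E A q" "\<And>B r. (B, r) \<in> E \<Longrightarrow> B \<subseteq> C \<or> B \<inter> C = {}"
proof -
  have "compact_open_in W (A \<inter> C)" "compact_open_in W (A - C)"
    using Trim_compact_open[OF A] C hausdorff compact_open_in_Int compact_open_in_Diff by auto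
  then obtain \<F> \<G> where
    \<F>: "finite \<F>" "\<And>T. T \<in> \<F> \<Longrightarrow> \<exists>p\<in>P. T \<in> Trim W P ltP Z p" "disjoint \<F>" "\<Union>\<F> = A \<inter> C" and
    \<G>: "finite \<G>" "\<And>T. T \<in> \<G> \<Longrightarrow> \<exists>p\<in>P. T \<in> Trim W P ltP Z p" "disjoint \<G>" "\<Union>\<G> = A - C"
    using compact_open_disjoint_trims by metis
  have "disjoint (\<F> \<union> \<G>)"
    using \<F>(3,4) \<G>(3,4) by (intro disjoint_union) auto
  then obtain E where E: "subdivides E A q" "fst ` E = \<F> \<union> \<G>"
    using label_decomposition[OF q A, of "\<F> \<union> \<G>"] \<F> \<G> by (metis Int_Diff_Un UnE Union_Un_distrib finite_UnI)
  have "B \<subseteq> C \<or> B \<inter> C = {}" if "(B, r) \<in> E" for B r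
  proof -
    have "B \<in> \<F> \<union> \<G>" using that E(2) by force
    then show ?thesis using \<F>(4) \<G>(4) by blast
  qed
  with E(1) that show thesis by blast
qed

text \<open>Points of \<open>Z (\<alpha> r)\<close> accumulate at the points of \<open>Z (\<alpha> q)\<close> when \<open>q < r\<close>, so an
  \<open>r\<close>-labelled piece can be split off a \<open>q\<close>-labelled set without using up its label.\<close>

lemma subdivide_split_off:
  assumes q: "q \<in> Q" and A: "A \<in> Trim W P ltP Z (\<alpha> q)" and r: "r \<in> Q" "ltQ q r"
  obtains E B B' where "subdivides E A q" "(B, r) \<in> E" "(B', q) \<in> E" "B \<noteq> B'"
proof -
  note p = \<alpha>_in_P[OF q] \<alpha>_in_P[OF r(1)]
  obtain x where x: "x \<in> A" "x \<in> Z (\<alpha> q)" using A p by (auto simp: Trim_iff)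
  obtain y where y: "y \<in> A" "y \<in> Z (\<alpha> r)" "y \<noteq> x"
    using open_meets_above[OF Trim_openin[OF A] x p morphism_less[OF q r]] by blast
  have "closedin W {x}"
    using x Z_subset[OF p(1)] hausdorff by (auto intro: closedin_Hausdorff_singleton)
  then have "openin W (A - {x})" using Trim_openin[OF A] by (simp add: openin_diff)
  then obtain B where B: "B \<in> Trim W P ltP Z (\<alpha> r)" "y \<in> B" "B \<subseteq> A - {x}"
    using trim_nbhd[of "A - {x}" y "\<alpha> r"] y p by blast
  have "A - B \<in> Trim W P ltP Z (\<alpha> q)"
    using Trim_subset[OF p(1) A compact_open_in_Diff[OF hausdorff Trim_compact_open Trim_compact_open]]
      A B x by blast
  moreover have "A - B \<noteq> B" using B by blast
  moreover have "labelled_family {(A - B, q), (B, r)}"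
    using calculation B(1) q r(1) by (auto simp: labelled_family_def)
  moreover have "carrier_of {(A - B, q), (B, r)} = A" using B by auto
  ultimately have "subdivides {(A - B, q), (B, r)} A q"
    using r(2) by (intro subdividesI[of _ A "A - B"]) auto
  then show thesis using that \<open>A - B \<noteq> B\<close> by blast
qed


section \<open>Extending labelled families\<close>

lemma labelled_family_of_compact_open:
  assumes "compact_open_in W C"
  obtains G where "labelled_family G" "carrier_of G = C"
proof -
  obtain \<F> where \<F>: "finite \<F>" "\<And>T. T \<in> \<F> \<Longrightarrow> \<exists>p\<in>P. T \<in> Trim W P ltP Z p"
    "disjoint \<F>" "\<Union>\<F> = C"
    using compact_open_disjoint_trims[OF assms] by blast
  then have "\<exists>q\<in>Q. T \<in> Trim W P ltP Z (\<alpha> q)" if "T \<in> \<F>" for T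
    using that surjective by blast
  then obtain l where l: "\<And>T. T \<in> \<F> \<Longrightarrow> l T \<in> Q \<and> T \<in> Trim W P ltP Z (\<alpha> (l T))" by metis
  show thesis
    using that labelled_family_image[OF \<F>(1,3) l] \<F>(4) by blast
qed

lemma refine_resolving:
  assumes D: "labelled_family D" and C: "compact_open_in W C"
  obtains D' where "labelled_family D'" "refines_family D' D"
    "\<And>w. w \<in> C \<Longrightarrow> \<exists>A q. (A, q) \<in> D' \<and> w \<in> A \<and> A \<subseteq> C"
proof -
  obtain G where G: "labelled_family G" "carrier_of G = C - carrier_of D"
    by (rule labelled_family_of_compact_open
        [OF compact_open_in_Diff[OF hausdorff C carrier_of_compact_open[OF D]]])
  have "\<exists>E. subdivides E A q \<and> (\<forall>B r. (B, r) \<in> E \<longrightarrow> B \<subseteq> C \<or> B \<inter> C = {})" if "(A, q) \<in> D" for A q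
    by (rule subdivide_by_compact_open[OF labelled_familyD(1,2)[OF D that] C]) blast
  then obtain E where E: "\<And>A q. (A, q) \<in> D \<Longrightarrow> subdivides (E A q) A q"
    "\<And>A q B r. (A, q) \<in> D \<Longrightarrow> (B, r) \<in> E A q \<Longrightarrow> B \<subseteq> C \<or> B \<inter> C = {}" by metis
  have dis: "carrier_of D \<inter> carrier_of G = {}" using G(2) by blast
  let ?D' = "(\<Union>(A, q)\<in>D. E A q) \<union> G"
  have D': "labelled_family ?D'" "refines_family ?D' D"
    using refine_memberwise[OF D E(1) G(1) dis] by auto
  have "\<exists>A q. (A, q) \<in> ?D' \<and> w \<in> A \<and> A \<subseteq> C" if w: "w \<in> C" for w
  proof (cases "w \<in> carrier_of D")
    case True
    then obtain A q where A: "(A, q) \<in> D" "w \<in> A" by (rule carrier_ofE)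
    then have "w \<in> carrier_of (E A q)" using E(1) by (simp add: subdivides_def)
    then obtain B r where B: "(B, r) \<in> E A q" "w \<in> B" by (rule carrier_ofE)
    then have "B \<subseteq> C" using E(2)[OF A(1)] w by blast
    moreover have "(B, r) \<in> ?D'" using A B by blast
    ultimately show ?thesis using B by blast
  next
    case False
    then have "w \<in> carrier_of G" using w G(2) by blast
    then obtain B r where B: "(B, r) \<in> G" "w \<in> B" by (rule carrier_ofE)
    then have "B \<subseteq> C" using subset_carrier_of[OF B(1)] G(2) by blast
    then show ?thesis using B by blast
  qed
  with D' that show thesis by blast
qed

lemma refine_adding_label:
  assumes D: "labelled_family D" and r: "r \<in> Q"
  obtains D' where "labelled_family D'" "refines_family D' D"
    "\<not> Z (\<alpha> r) \<subseteq> carrier_of D \<Longrightarrow> \<exists>A. (A, r) \<in> D'"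
    "\<And>A q. (A, q) \<in> D \<Longrightarrow> ltQ q r \<Longrightarrow>
      \<exists>B B'. (B, r) \<in> D' \<and> (B', q) \<in> D' \<and> B \<subseteq> A \<and> B' \<subseteq> A \<and> B \<noteq> B'"
proof -
  have "\<exists>G. labelled_family G \<and> carrier_of D \<inter> carrier_of G = {} \<and>
     (\<not> Z (\<alpha> r) \<subseteq> carrier_of D \<longrightarrow> (\<exists>A. (A, r) \<in> G))"
  proof (cases "Z (\<alpha> r) \<subseteq> carrier_of D")
    case True
    then show ?thesis by (intro exI[of _ "{}"]) (auto simp: labelled_family_def)
  next
    case False
    then obtain y where y: "y \<in> Z (\<alpha> r)" "y \<notin> carrier_of D" by blast
    have "closedin W (carrier_of D)"
      using carrier_of_compact_open[OF D] hausdorff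
      by (simp add: compact_open_in_def compactin_imp_closedin)
    then have "openin W (topspace W - carrier_of D)" by blast
    moreover have "y \<in> topspace W - carrier_of D" using y Z_subset[OF \<alpha>_in_P[OF r]] by blast
    ultimately obtain B where "B \<in> Trim W P ltP Z (\<alpha> r)" "B \<subseteq> topspace W - carrier_of D"
      using trim_nbhd[OF _ _ y(1) \<alpha>_in_P[OF r]] by metis
    then show ?thesis
      using labelled_family_singleton[OF r] by (intro exI[of _ "{(B, r)}"]) auto
  qed
  then obtain G where G: "labelled_family G" "carrier_of D \<inter> carrier_of G = {}"
    "\<not> Z (\<alpha> r) \<subseteq> carrier_of D \<Longrightarrow> \<exists>A. (A, r) \<in> G" by blast
  have "\<exists>E. subdivides E A q \<and> (ltQ q r \<longrightarrow> (\<exists>B B'. (B, r) \<in> E \<and> (B', q) \<in> E \<and> B \<noteq> B'))"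
    if "(A, q) \<in> D" for A q
  proof (cases "ltQ q r")
    case True
    then show ?thesis using subdivide_split_off[OF labelled_familyD(1,2)[OF D that] r] by metis
  next
    case False
    then show ?thesis using subdivides_self[OF labelled_familyD(1,2)[OF D that]] by blast
  qed
  then obtain E where E: "\<And>A q. (A, q) \<in> D \<Longrightarrow> subdivides (E A q) A q"
    "\<And>A q. (A, q) \<in> D \<Longrightarrow> ltQ q r \<Longrightarrow> \<exists>B B'. (B, r) \<in> E A q \<and> (B', q) \<in> E A q \<and> B \<noteq> B'"
    by metis
  let ?D' = "(\<Union>(A, q)\<in>D. E A q) \<union> G"
  have D': "labelled_family ?D'" "refines_family ?D' D"
    using refine_memberwise[OF D E(1) G(1,2)] by auto
  have "\<exists>B B'. (B, r) \<in> ?D' \<and> (B', q) \<in> ?D' \<and> B \<subseteq> A \<and> B' \<subseteq> A \<and> B \<noteq> B'"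
    if A: "(A, q) \<in> D" "ltQ q r" for A q
  proof -
    obtain B B' where B: "(B, r) \<in> E A q" "(B', q) \<in> E A q" "B \<noteq> B'" using E(2)[OF A] by blast
    have "labelled_family (E A q)" "carrier_of (E A q) = A"
      using E(1)[OF A(1)] by (auto simp: subdivides_def)
    then have "B \<subseteq> A" "B' \<subseteq> A" using labelled_familyD(4) B by metis+
    then show ?thesis using A(1) B by blast
  qed
  then show thesis using that[OF D'] G(3) by blast
qed

text \<open>An initial family may realise any finite set of labels, provided that distinct labels can
  be witnessed by distinct points.\<close>

lemma labelled_family_with_labels:
  assumes "finite F" "F \<subseteq> Q" "inj_on x F" "\<And>q. q \<in> F \<Longrightarrow> x q \<in> Z (\<alpha> q)"
  obtains D where "labelled_family D" "\<And>q. q \<in> F \<Longrightarrow> \<exists>A. (A, q) \<in> D"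
proof -
  have "\<exists>D. labelled_family D \<and> (\<forall>q\<in>G. \<exists>A. (A, q) \<in> D) \<and> x ` (F - G) \<inter> carrier_of D = {}"
    if "finite G" "G \<subseteq> F" for G
    using that
  proof (induction G)
    case empty
    show ?case by (rule exI[of _ "{}"]) (auto simp: labelled_family_def)
  next
    case (insert q G)
    then obtain D where D: "labelled_family D" "\<forall>q\<in>G. \<exists>A. (A, q) \<in> D"
      "x ` (F - G) \<inter> carrier_of D = {}" by auto
    let ?X = "x ` (F - insert q G)"
    have q: "q \<in> F" "q \<in> Q" "q \<notin> G" using insert assms(2) by auto
    have top: "x s \<in> topspace W" if "s \<in> F" for s
      using assms(2,4) Z_subset \<alpha>_in_P that by blast
    have "closedin W (carrier_of D)"
      using carrier_of_compact_open[OF D(1)] hausdorff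
      by (simp add: compact_open_in_def compactin_imp_closedin)
    moreover have "closedin W ?X"
    proof (rule compactin_imp_closedin[OF hausdorff finite_imp_compactin])
      show "?X \<subseteq> topspace W" "finite ?X" using top assms(1) by auto
    qed
    ultimately have "openin W (topspace W - (carrier_of D \<union> ?X))" by blast
    moreover have "x q \<notin> ?X" using assms(3) q(1) insert.prems by (auto simp: inj_on_def)
    then have "x q \<in> topspace W - (carrier_of D \<union> ?X)" using D(3) q top by blast
    ultimately obtain B where B: "B \<in> Trim W P ltP Z (\<alpha> q)" "B \<subseteq> topspace W - (carrier_of D \<union> ?X)"
      using trim_nbhd[OF _ _ assms(4)[OF q(1)] \<alpha>_in_P[OF q(2)]] by metis
    have "labelled_family (D \<union> {(B, q)})"
      using B by (intro labelled_family_Un D(1) labelled_family_singleton q) auto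
    moreover have "?X \<inter> carrier_of (D \<union> {(B, q)}) = {}" using B(2) D(3) by auto
    ultimately show ?case using D(2) by (intro exI[of _ "D \<union> {(B, q)}"]) auto
  qed
  from this[OF assms(1) subset_refl] that show thesis by blast
qed

end


section \<open>The partition defined by a chain of labelled families\<close>

text \<open>Each assumption on the chain serves one property of the limit. \<open>resolving\<close> makes the
  members a base of the topology, and \<open>exhausting\<close> makes the classes nonempty. \<open>splitting\<close> makes
  the points of type \<open>q\<close> limit points of each class \<open>r > q\<close>; the inequality \<open>B \<noteq> B'\<close> matters
  only for \<open>r = q\<close>, where a single piece would not give a second point.\<close>

locale labelled_chain = trim_labelling W P ltP Z Q ltQ \<alpha>
  for W :: "'a topology" and P :: "'p set" and ltP :: "'p \<Rightarrow> 'p \<Rightarrow> bool"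
    and Z :: "'p \<Rightarrow> 'a set" and Q :: "'q set" and ltQ :: "'q \<Rightarrow> 'q \<Rightarrow> bool" and \<alpha> :: "'q \<Rightarrow> 'p" +
  fixes D :: "nat \<Rightarrow> ('a set \<times> 'q) set"
  assumes family: "labelled_family (D n)"
    and refines_Suc: "refines_family (D (Suc n)) (D n)"
    and resolving: "compact_open_in W C \<Longrightarrow> \<exists>n. \<forall>w\<in>C. \<exists>A q. (A, q) \<in> D n \<and> w \<in> A \<and> A \<subseteq> C"
    and splitting: "(A, q) \<in> D n \<Longrightarrow> r \<in> Q \<Longrightarrow> ltQ q r \<Longrightarrow>
      \<exists>m\<ge>n. \<exists>B B'. (B, r) \<in> D m \<and> (B', q) \<in> D m \<and> B \<subseteq> A \<and> B' \<subseteq> A \<and> B \<noteq> B'"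
    and exhausting: "q \<in> Q \<Longrightarrow> \<exists>n A r. (A, r) \<in> D n \<and> po_le ltQ r q"
begin

definition limit_class :: "'q \<Rightarrow> 'a set" where
  "limit_class q = {w. \<exists>n. \<forall>m\<ge>n. \<exists>A. (A, q) \<in> D m \<and> w \<in> A}"

lemmas memberD = labelled_familyD[OF family]

lemma refines: "n \<le> m \<Longrightarrow> refines_family (D m) (D n)"
proof (induction m rule: dec_induct)
  case base
  show ?case using refines_family_refl family by blast
next
  case (step m)
  then show ?case using refines_family_trans[OF family family family _ refines_Suc] by blast
qed

lemma overlap_refines:
  assumes "(A, q) \<in> D n" "(B, r) \<in> D m" "n \<le> m" "w \<in> A" "w \<in> B"
  shows "B \<subseteq> A" "po_le ltQ q r"
proof -
  have "A \<inter> B \<noteq> {}" using assms by blast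
  then show "B \<subseteq> A" "po_le ltQ q r"
    using refines_familyD(1,2)[OF refines[OF assms(3)] assms(1,2)] by auto
qed

lemma covered_later:
  assumes "(A, q) \<in> D n" "w \<in> A" "n \<le> m"
  obtains B r where "(B, r) \<in> D m" "w \<in> B"
proof -
  have "w \<in> carrier_of (D m)"
    using refines_family_carrier[OF refines[OF assms(3)]] subset_carrier_of[OF assms(1)] assms(2) by blast
  then show thesis using that by (rule carrier_ofE)
qed

lemma limit_class_eventually_unique:
  assumes "w \<in> limit_class q" "w \<in> limit_class r"
  shows "q = r"
proof -
  obtain n k where n: "\<And>m. n \<le> m \<Longrightarrow> \<exists>A. (A, q) \<in> D m \<and> w \<in> A"
    and k: "\<And>m. k \<le> m \<Longrightarrow> \<exists>A. (A, r) \<in> D m \<and> w \<in> A"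
    using assms unfolding limit_class_def by blast
  obtain A B where "(A, q) \<in> D (max n k)" "w \<in> A" "(B, r) \<in> D (max n k)" "w \<in> B"
    using n[of "max n k"] k[of "max n k"] by auto
  then show ?thesis using labelled_family_overlap[OF family, of A q _ B r] by blast
qed

text \<open>A \<open>q\<close>-labelled member contains a descending chain of \<open>q\<close>-labelled members, whose
  intersection is nonempty by compactness.\<close>

lemma member_meets_own_class:
  assumes "(A, q) \<in> D n"
  shows "A \<inter> limit_class q \<noteq> {}"
proof -
  have "\<exists>B. \<forall>k. (B k, q) \<in> D (n + k) \<and> (k = 0 \<longrightarrow> B k = A) \<and> B (Suc k) \<subseteq> B k"
  proof -
    have "\<exists>B. \<forall>k. ((B k, q) \<in> D (n + k) \<and> (k = 0 \<longrightarrow> B k = A)) \<and> B (Suc k) \<subseteq> B k"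
    proof (rule dependent_nat_choice)
      show "\<exists>X. (X, q) \<in> D (n + 0) \<and> (0 = (0::nat) \<longrightarrow> X = A)" using assms by simp
    next
      fix X k assume X: "(X, q) \<in> D (n + k) \<and> (k = 0 \<longrightarrow> X = A)"
      obtain B where "(B, q) \<in> D (Suc (n + k))" "B \<subseteq> X"
        using refines_familyD(3)[OF refines_Suc conjunct1[OF X]] by blast
      then show "\<exists>B. ((B, q) \<in> D (n + Suc k) \<and> (Suc k = 0 \<longrightarrow> B = A)) \<and> B \<subseteq> X" by auto
    qed
    then show ?thesis by blast
  qed
  then obtain B where B: "\<And>k. (B k, q) \<in> D (n + k)" "B 0 = A" "\<And>k. B (Suc k) \<subseteq> B k" by blast
  have "(\<Inter>k. B k) \<noteq> {}"
    using nested_compactin_Inter_nonempty[OF hausdorff, of B] B(3) memberD(3,5)[OF B(1)]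
    by (simp add: compact_open_in_def)
  then obtain w where w: "\<And>k. w \<in> B k" by blast
  have "\<exists>A. (A, q) \<in> D m \<and> w \<in> A" if "n \<le> m" for m
    using B(1)[of "m - n"] w[of "m - n"] that by auto
  then have "w \<in> limit_class q" by (auto simp: limit_class_def)
  then show ?thesis using w[of 0] B(2) by blast
qed

lemma label_le_class:
  assumes "(A, q) \<in> D n" "w \<in> A" "w \<in> limit_class r"
  shows "po_le ltQ q r"
proof -
  obtain k where "\<And>m. k \<le> m \<Longrightarrow> \<exists>B. (B, r) \<in> D m \<and> w \<in> B"
    using assms(3) by (auto simp: limit_class_def)
  then obtain B where "(B, r) \<in> D (max n k)" "w \<in> B" by (meson max.cobounded2)
  then show ?thesis using overlap_refines(2)[OF assms(1)] assms(2) by simp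
qed

lemma small_members:
  assumes "openin W U" "w \<in> U"
  obtains n where "\<And>m. n \<le> m \<Longrightarrow> \<exists>A q. (A, q) \<in> D m \<and> w \<in> A"
    "\<And>m A q. n \<le> m \<Longrightarrow> (A, q) \<in> D m \<Longrightarrow> w \<in> A \<Longrightarrow> A \<subseteq> U"
proof -
  obtain C where C: "compact_open_in W C" "w \<in> C" "C \<subseteq> U"
    using stone_space_compact_open_nbhd[OF stone assms] .
  obtain n A q where A: "(A, q) \<in> D n" "w \<in> A" "A \<subseteq> C"
    using resolving[OF C(1)] C(2) by blast
  show thesis
  proof (rule that)
    show "\<exists>B r. (B, r) \<in> D m \<and> w \<in> B" if "n \<le> m" for m
      using covered_later[OF A(1,2) that] by blast
    show "B \<subseteq> U" if "n \<le> m" "(B, r) \<in> D m" "w \<in> B" for m B r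
      using overlap_refines(1)[OF A(1) that(2,1) A(2) that(3)] A(3) C(3) by blast
  qed
qed

lemma class_small_member:
  assumes "openin W U" "w \<in> U" "w \<in> limit_class q"
  obtains n A where "(A, q) \<in> D n" "w \<in> A" "A \<subseteq> U"
proof -
  obtain k where k: "\<And>m. k \<le> m \<Longrightarrow> \<exists>A. (A, q) \<in> D m \<and> w \<in> A"
    using assms(3) by (auto simp: limit_class_def)
  obtain n where n: "\<And>m A q. n \<le> m \<Longrightarrow> (A, q) \<in> D m \<Longrightarrow> w \<in> A \<Longrightarrow> A \<subseteq> U"
    using small_members[OF assms(1,2)] by metis
  obtain A where "(A, q) \<in> D (max n k)" "w \<in> A" using k[of "max n k"] by auto
  with n[of "max n k" A q] that show thesis by simp
qed

lemma limit_class_subset_topspace: "limit_class q \<subseteq> topspace W"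
proof
  fix w assume "w \<in> limit_class q"
  then obtain n A where "(A, q) \<in> D n" "w \<in> A" by (auto simp: limit_class_def)
  then show "w \<in> topspace W" using memberD(6) openin_subset by blast
qed

lemma member_meets_iff:
  assumes "(A, q) \<in> D n" "r \<in> Q"
  shows "A \<inter> limit_class r \<noteq> {} \<longleftrightarrow> po_le ltQ q r"
proof
  assume "A \<inter> limit_class r \<noteq> {}"
  then show "po_le ltQ q r" using label_le_class assms(1) by blast
next
  assume le: "po_le ltQ q r"
  show "A \<inter> limit_class r \<noteq> {}"
  proof (cases "ltQ q r")
    case True
    then obtain m B where "(B, r) \<in> D m" "B \<subseteq> A" using splitting[OF assms] by blast
    then show ?thesis using member_meets_own_class by blast
  next
    case False
    then have "q = r" using le by (simp add: po_le_def)
    then show ?thesis using member_meets_own_class assms(1) by blast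
  qed
qed

lemma discrete_member_unique_point:
  assumes A: "(A, q) \<in> D n" and q: "\<not> ltQ q q"
    and w: "w \<in> A" "w \<in> limit_class q" and v: "v \<in> A" "v \<in> limit_class q"
  shows "w = v"
proof (rule ccontr)
  assume "w \<noteq> v"
  have "closedin W {v}"
    using v(2) limit_class_subset_topspace hausdorff by (auto intro: closedin_Hausdorff_singleton)
  then have U: "openin W (topspace W - {v})" "w \<in> topspace W - {v}"
    using w(2) limit_class_subset_topspace \<open>w \<noteq> v\<close> by auto
  obtain k l where k: "\<And>m. k \<le> m \<Longrightarrow> \<exists>B. (B, q) \<in> D m \<and> w \<in> B"
    and l: "\<And>m. l \<le> m \<Longrightarrow> \<exists>B. (B, q) \<in> D m \<and> v \<in> B"
    using w(2) v(2) unfolding limit_class_def by blast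
  obtain i where i: "\<And>m B r. i \<le> m \<Longrightarrow> (B, r) \<in> D m \<Longrightarrow> w \<in> B \<Longrightarrow> B \<subseteq> topspace W - {v}"
    using small_members[OF U] by metis
  \<comment> \<open>At a stage late enough to separate the two points, they lie in different \<open>q\<close>-labelled
    members, whereas a discrete label passes to a single piece.\<close>
  define m where "m = Max {n, k, l, i}"
  have m: "n \<le> m" "k \<le> m" "l \<le> m" "i \<le> m" by (auto simp: m_def)
  obtain B C where B: "(B, q) \<in> D m" "w \<in> B" and C: "(C, q) \<in> D m" "v \<in> C"
    using k[OF m(2)] l[OF m(3)] by blast
  have "B \<subseteq> A" "C \<subseteq> A"
    using overlap_refines(1)[OF A B(1) m(1) w(1) B(2)] overlap_refines(1)[OF A C(1) m(1) v(1) C(2)] .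
  then have "B = C" using refines_familyD(4)[OF refines[OF m(1)] A q B(1) C(1)] by blast
  then show False using i[OF m(4) B] C(2) by blast
qed

lemma member_Trim:
  assumes "(A, q) \<in> D n"
  shows "A \<in> Trim W Q ltQ limit_class q"
proof -
  have "card (A \<inter> limit_class q) = 1" if "\<not> ltQ q q"
  proof -
    obtain w where "w \<in> A \<inter> limit_class q" using member_meets_own_class[OF assms] by blast
    then have "A \<inter> limit_class q = {w}" using discrete_member_unique_point[OF assms that] by blast
    then show ?thesis by simp
  qed
  moreover have "type_of_set Q limit_class A = up_set Q ltQ {q}"
    using member_meets_iff[OF assms] by (auto simp: type_of_set_def up_set_def)
  ultimately show ?thesis
    using memberD(5)[OF assms] by (simp add: Trim_def po_discrete_def)
qed

lemma limit_class_po_partition: "po_partition W Q ltQ limit_class"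
  unfolding po_partition_def
proof (intro conjI ballI)
  fix q assume q: "q \<in> Q"
  obtain n A r where "(A, r) \<in> D n" "po_le ltQ r q" using exhausting[OF q] by blast
  then show "limit_class q \<noteq> {}" using member_meets_iff[of A r n q] q by blast
  show "limit_class q \<subseteq> topspace W" by (rule limit_class_subset_topspace)
  show "W derived_set_of (limit_class q) \<inter> (\<Union>r\<in>Q. limit_class r) = (\<Union>r\<in>{r \<in> Q. ltQ r q}. limit_class r)"
  proof (intro equalityI subsetI)
    fix w assume "w \<in> W derived_set_of (limit_class q) \<inter> (\<Union>r\<in>Q. limit_class r)"
    then obtain r where r: "r \<in> Q" "w \<in> limit_class r" and w: "w \<in> W derived_set_of (limit_class q)" by blast
    obtain n A where A: "(A, r) \<in> D n" "w \<in> A"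
      using r(2) by (auto simp: limit_class_def)
    obtain v where v: "v \<noteq> w" "v \<in> limit_class q" "v \<in> A"
      using w A memberD(6)[OF A(1)] unfolding in_derived_set_of by blast
    have "po_le ltQ r q" using label_le_class[OF A(1) v(3,2)] .
    moreover have "ltQ q q" if "r = q"
      using discrete_member_unique_point[OF A(1)] that A(2) r(2) v by blast
    ultimately show "w \<in> (\<Union>r\<in>{r \<in> Q. ltQ r q}. limit_class r)" using r by (auto simp: po_le_def)
  next
    fix w assume "w \<in> (\<Union>r\<in>{r \<in> Q. ltQ r q}. limit_class r)"
    then obtain r where r: "r \<in> Q" "ltQ r q" "w \<in> limit_class r" by blast
    have "\<exists>v. v \<noteq> w \<and> v \<in> limit_class q \<and> v \<in> U" if U: "openin W U" "w \<in> U" for U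
    proof -
      obtain n A where A: "(A, r) \<in> D n" "w \<in> A" "A \<subseteq> U"
        using class_small_member[OF U r(3)] .
      obtain m B B' where B: "(B, q) \<in> D m" "(B', r) \<in> D m" "B \<subseteq> A" "B' \<subseteq> A" "B \<noteq> B'"
        using splitting[OF A(1) q r(2)] by blast
      \<comment> \<open>For \<open>r = q\<close> the two disjoint pieces supply two points of \<open>limit_class q\<close>, one of which is not \<open>w\<close>.\<close>
      obtain u v where u: "u \<in> B" "u \<in> limit_class q" and v: "v \<in> B'" "v \<in> limit_class r"
        using member_meets_own_class[OF B(1)] member_meets_own_class[OF B(2)] by blast
      have "u \<in> U" "v \<in> U" using u(1) v(1) B(3,4) A(3) by auto
      moreover have "u \<noteq> w" if "r \<noteq> q" using limit_class_eventually_unique[OF _ r(3)] u(2) that by blast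
      moreover have "u \<noteq> v" using labelled_family_overlap[OF family B(1,2)] B(5) u(1) v(1) by blast
      ultimately show ?thesis using u(2) v(2) by (cases "r = q"; cases "u = w") auto
    qed
    then have "w \<in> W derived_set_of (limit_class q)"
      using r(3) limit_class_subset_topspace unfolding in_derived_set_of by blast
    then show "w \<in> W derived_set_of (limit_class q) \<inter> (\<Union>r\<in>Q. limit_class r)" using r by blast
  qed
qed (auto simp: disjoint_family_on_def dest: limit_class_eventually_unique)

text \<open>The members themselves are the trim sets that the first and third trimness conditions ask for.
  For the second one, a neighbourhood base of \<open>q\<close>-trim sets interleaves with the members
  containing the point, and comparing types forces the labels of the latter to be equal to \<open>q\<close>
  eventually.\<close>

lemma limit_class_trim_partition: "trim_partition W Q ltQ limit_class"
  unfolding trim_partition_def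
proof (intro conjI limit_class_po_partition)
  show "trim_T1 W Q ltQ limit_class"
    unfolding trim_T1_def neighbourhood_base_at_def
  proof (intro ballI allI impI)
    fix w U assume U: "openin W U \<and> w \<in> U"
    obtain n where n: "\<And>m. n \<le> m \<Longrightarrow> \<exists>A q. (A, q) \<in> D m \<and> w \<in> A"
      "\<And>m A q. n \<le> m \<Longrightarrow> (A, q) \<in> D m \<Longrightarrow> w \<in> A \<Longrightarrow> A \<subseteq> U"
      using small_members[OF conjunct1[OF U] conjunct2[OF U]] by metis
    obtain A q where A: "(A, q) \<in> D n" "w \<in> A" using n(1) by blast
    show "\<exists>V A. openin W V \<and> (\<exists>q\<in>Q. A \<in> Trim W Q ltQ limit_class q) \<and> w \<in> V \<and> V \<subseteq> A \<and> A \<subseteq> U"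
    proof (intro exI conjI bexI)
      show "openin W A" "q \<in> Q" using memberD[OF A(1)] by auto
      show "A \<in> Trim W Q ltQ limit_class q" using member_Trim A by blast
      show "A \<subseteq> U" using n(2) A by blast
    qed (use A in auto)
  qed
  show "trim_T2 W Q ltQ limit_class"
    unfolding trim_T2_def
  proof (intro ballI impI)
    fix q w assume "q \<in> po_hat W Q ltQ limit_class" "w \<in> topspace W"
      and base: "neighbourhood_base_at w (\<lambda>A. A \<in> Trim W Q ltQ limit_class q) W"
    then have q: "q \<in> Q" by (simp add: po_hat_def)
    have ty: "A \<inter> limit_class r \<noteq> {} \<longleftrightarrow> po_le ltQ q r" if "A \<in> Trim W Q ltQ limit_class q" "r \<in> Q" for A r
    proof -
      have "type_of_set Q limit_class A = up_set Q ltQ {q}" using that(1) by (simp add: Trim_def)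
      then show ?thesis using that(2) by (auto simp: type_of_set_def up_set_def)
    qed
    have ex: "\<exists>T. T \<in> Trim W Q ltQ limit_class q \<and> w \<in> T \<and> T \<subseteq> U" if "openin W U" "w \<in> U" for U
      using base that unfolding neighbourhood_base_at_def by blast
    obtain T where T: "T \<in> Trim W Q ltQ limit_class q" "w \<in> T"
      using ex[of "topspace W"] \<open>w \<in> topspace W\<close> by auto
    have "openin W T" using T(1) by (simp add: Trim_def compact_open_in_def)
    then obtain n where n: "\<And>m. n \<le> m \<Longrightarrow> \<exists>A r. (A, r) \<in> D m \<and> w \<in> A"
      "\<And>m A r. n \<le> m \<Longrightarrow> (A, r) \<in> D m \<Longrightarrow> w \<in> A \<Longrightarrow> A \<subseteq> T"
      using small_members[OF _ T(2)] by metis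
    have "\<exists>A. (A, q) \<in> D m \<and> w \<in> A" if m: "n \<le> m" for m
    proof -
      obtain A r where A: "(A, r) \<in> D m" "w \<in> A" using n(1)[OF m] by blast
      note r = memberD(1)[OF A(1)]
      have "T \<inter> limit_class r \<noteq> {}" using member_meets_own_class[OF A(1)] n(2)[OF m A] by blast
      then have "po_le ltQ q r" using ty[OF T(1) r] by blast
      moreover obtain S where S: "S \<in> Trim W Q ltQ limit_class q" "S \<subseteq> A"
        using ex[OF memberD(6)[OF A(1)] A(2)] by blast
      have "S \<inter> limit_class q \<noteq> {}" using ty[OF S(1) q] by (simp add: po_le_def)
      then have "po_le ltQ r q" using label_le_class[OF A(1)] S(2) by blast
      ultimately show ?thesis using leQ_antisym[OF q r] A by blast
    qed
    then show "w \<in> limit_class q" by (auto simp: limit_class_def)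
  qed
  show "trim_T3 W Q ltQ limit_class"
    unfolding trim_T3_def
  proof (intro ballI)
    fix q w assume w: "w \<in> limit_class q"
    then obtain n A where "(A, q) \<in> D n" "w \<in> A"
      by (auto simp: limit_class_def)
    then show "\<exists>A\<in>Trim W Q ltQ limit_class q. w \<in> A" using member_Trim by blast
  qed
qed

text \<open>The members containing a point of the class form a base of \<open>\<alpha> q\<close>-trim sets for \<open>Z\<close>.\<close>

lemma limit_class_subset_Z:
  assumes q: "q \<in> Q"
  shows "limit_class q \<subseteq> Z (\<alpha> q)"
proof
  fix w assume w: "w \<in> limit_class q"
  then have top: "w \<in> topspace W" using limit_class_subset_topspace by blast
  have *: "\<exists>A\<in>Trim W P ltP Z (\<alpha> q). openin W A \<and> w \<in> A \<and> A \<subseteq> U" if U: "openin W U" "w \<in> U" for U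
  proof -
    obtain n A where A: "(A, q) \<in> D n" "w \<in> A" "A \<subseteq> U" using class_small_member[OF U w] .
    then show ?thesis using memberD(2,6)[OF A(1)] by blast
  qed
  then have "\<alpha> q \<in> po_hat W P ltP Z"
    using top \<alpha>_in_P[OF q] by (auto simp: po_hat_def)
  moreover have "neighbourhood_base_at w (\<lambda>A. A \<in> Trim W P ltP Z (\<alpha> q)) W"
    unfolding neighbourhood_base_at_def using * by blast
  ultimately show "w \<in> Z (\<alpha> q)"
    using trim top unfolding trim_partition_def trim_T2_def by blast
qed

text \<open>Regularity comes from members inside the given trim set: one that contains a point of type
  \<open>p\<close> has a label that \<open>\<alpha>\<close> maps to \<open>p\<close>, and it meets its own class.\<close>

lemma limit_class_regularly_refines: "regularly_refines W Q ltQ limit_class \<alpha> P ltP Z"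
  unfolding regularly_refines_def
proof (intro conjI ballI)
  show "po_partition W Q ltQ limit_class" by (rule limit_class_po_partition)
  show "trim_T1 W Q ltQ limit_class" using limit_class_trim_partition by (simp add: trim_partition_def)
  show "po_partition W P ltP Z" "trim_T1 W P ltP Z" using trim by (simp_all add: trim_partition_def)
  show "\<alpha> ` Q \<subseteq> P" using surjective by simp
  show "\<And>q. q \<in> Q \<Longrightarrow> limit_class q \<subseteq> Z (\<alpha> q)" by (rule limit_class_subset_Z)
next
  fix p A assume "p \<in> po_hat W P ltP Z" and A: "A \<in> Trim W P ltP Z p"
  then have p: "p \<in> P" by (simp add: po_hat_def)
  obtain x where x: "x \<in> A" "x \<in> Z p" using A p by (auto simp: Trim_iff)
  obtain n B q where B: "(B, q) \<in> D n" "x \<in> B" "B \<subseteq> A"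
    using small_members[OF Trim_openin[OF A] x(1)] by (metis order_refl)
  note q = memberD(1)[OF B(1)] and BT = memberD(2)[OF B(1)]
  have "po_le ltP (\<alpha> q) p"
    using BT \<alpha>_in_P[OF q] x(2) B(2) p by (auto simp: Trim_iff)
  moreover have "A \<inter> Z (\<alpha> q) \<noteq> {}"
    using BT \<alpha>_in_P[OF q] B(3) by (auto simp: Trim_iff)
  then have "po_le ltP p (\<alpha> q)"
    using A p \<alpha>_in_P[OF q] by (auto simp: Trim_iff)
  ultimately have "\<alpha> q = p" using le_antisym \<alpha>_in_P[OF q] p by blast
  moreover have "q \<in> type_of_set Q limit_class A"
    using member_meets_own_class[OF B(1)] B(3) q by (auto simp: type_of_set_def)
  ultimately show "p \<in> \<alpha> ` type_of_set Q limit_class A" by blast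
qed

end


section \<open>Existence of the chain\<close>

context trim_labelling
begin

text \<open>If a compact carrier contained \<open>Z (\<alpha> r)\<close>, then it would contain the closure as well, which
  would be compact; hence there is room for a new \<open>r\<close>-labelled set when it is not.\<close>

lemma refine_step:
  assumes D: "labelled_family D" and C: "compact_open_in W C" and r: "r \<in> Q"
  shows "\<exists>D'. labelled_family D' \<and> refines_family D' D \<and>
    (\<forall>w\<in>C. \<exists>A q. (A, q) \<in> D' \<and> w \<in> A \<and> A \<subseteq> C) \<and>
    (\<not> compactin W (W closure_of Z (\<alpha> r)) \<longrightarrow> (\<exists>A. (A, r) \<in> D')) \<and>
    (\<forall>A q. (A, q) \<in> D \<longrightarrow> ltQ q r \<longrightarrow>
      (\<exists>B B'. (B, r) \<in> D' \<and> (B', q) \<in> D' \<and> B \<subseteq> A \<and> B' \<subseteq> A \<and> B \<noteq> B'))"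
proof -
  obtain D1 where D1: "labelled_family D1" "refines_family D1 D"
    and res: "\<And>w. w \<in> C \<Longrightarrow> \<exists>A q. (A, q) \<in> D1 \<and> w \<in> A \<and> A \<subseteq> C"
    using refine_resolving[OF D C] by metis
  obtain D2 where D2: "labelled_family D2" "refines_family D2 D1"
    and new: "\<not> Z (\<alpha> r) \<subseteq> carrier_of D1 \<Longrightarrow> \<exists>A. (A, r) \<in> D2"
    and split: "\<And>A q. (A, q) \<in> D1 \<Longrightarrow> ltQ q r \<Longrightarrow>
      \<exists>B B'. (B, r) \<in> D2 \<and> (B', q) \<in> D2 \<and> B \<subseteq> A \<and> B' \<subseteq> A \<and> B \<noteq> B'"
    using refine_adding_label[OF D1(1) r] by metis
  have "\<exists>A q. (A, q) \<in> D2 \<and> w \<in> A \<and> A \<subseteq> C" if w: "w \<in> C" for w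
  proof -
    obtain A q where A: "(A, q) \<in> D1" "w \<in> A" "A \<subseteq> C" using res[OF w] by blast
    then have "w \<in> carrier_of D2"
      using refines_family_carrier[OF D2(2)] subset_carrier_of[OF A(1)] by blast
    then obtain B s where B: "(B, s) \<in> D2" "w \<in> B" by (rule carrier_ofE)
    then have "B \<subseteq> A" using refines_familyD(1)[OF D2(2) A(1) B(1)] A(2) by blast
    then show ?thesis using A(3) B by blast
  qed
  moreover have "\<exists>A. (A, r) \<in> D2" if nc: "\<not> compactin W (W closure_of Z (\<alpha> r))"
  proof (rule new, rule notI)
    assume sub: "Z (\<alpha> r) \<subseteq> carrier_of D1"
    have co: "compactin W (carrier_of D1)"
      using carrier_of_compact_open[OF D1(1)] by (simp add: compact_open_in_def)
    then have "W closure_of Z (\<alpha> r) \<subseteq> carrier_of D1"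
      using sub hausdorff by (simp add: closure_of_minimal compactin_imp_closedin)
    then show False using nc closed_compactin[OF co] by simp
  qed
  moreover have "\<exists>B B'. (B, r) \<in> D2 \<and> (B', q) \<in> D2 \<and> B \<subseteq> A \<and> B' \<subseteq> A \<and> B \<noteq> B'"
    if A: "(A, q) \<in> D" "ltQ q r" for A q
  proof -
    obtain A1 where A1: "(A1, q) \<in> D1" "A1 \<subseteq> A" using refines_familyD(3)[OF D1(2) A(1)] by blast
    then show ?thesis using split[OF A1(1) A(2)] by (meson subset_trans)
  qed
  moreover have "refines_family D2 D" using refines_family_trans[OF D D1(1) D2(1) D1(2) D2(2)] .
  ultimately show ?thesis using D2(1) by blast
qed

text \<open>The steps run through the countably many compact open sets and, infinitely often each,
  through the countably many elements of \<open>Q\<close>. Labels that are not forced by the initial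
  family \<open>D0\<close> can be added at a later step, since the corresponding sets \<open>Z (\<alpha> q)\<close> are not
  contained in any of the compact carriers.\<close>

lemma ex_labelled_chain:
  assumes co: "countable {A. compact_open_in W A}" and Q: "countable Q" "Q \<noteq> {}"
    and D0: "labelled_family D0"
    and ex: "\<And>q. q \<in> Q \<Longrightarrow> (\<exists>A r. (A, r) \<in> D0 \<and> po_le ltQ r q) \<or>
      \<not> compactin W (W closure_of Z (\<alpha> q))"
  obtains D where "labelled_chain W P ltP Z Q ltQ \<alpha> D"
proof -
  define c where "c = from_nat_into {A. compact_open_in W A}"
  define e where "e n = from_nat_into Q (fst (prod_decode n))" for n
  have ne: "{A. compact_open_in W A} \<noteq> {}"
    by (auto simp: compact_open_in_def intro: exI[of _ "{}"])
  have c: "compact_open_in W (c n)" for n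
    using from_nat_into[OF ne] by (simp add: c_def)
  have e: "e n \<in> Q" for n using from_nat_into[OF Q(2)] by (simp add: e_def)
  have c_surj: "\<exists>n. c n = C" if "compact_open_in W C" for C
    using from_nat_into_surj[OF co] that by (simp add: c_def)
  have e_surj: "\<exists>m\<ge>n. e m = r" if r: "r \<in> Q" for n r
  proof -
    obtain i where "from_nat_into Q i = r" using from_nat_into_surj[OF Q(1) r] by blast
    then have "e (prod_encode (i, n)) = r" by (simp add: e_def)
    then show ?thesis using le_prod_encode_2 by blast
  qed
  define step where "step n D D' \<longleftrightarrow> refines_family D' D \<and>
    (\<forall>w\<in>c n. \<exists>A q. (A, q) \<in> D' \<and> w \<in> A \<and> A \<subseteq> c n) \<and>
    (\<not> compactin W (W closure_of Z (\<alpha> (e n))) \<longrightarrow> (\<exists>A. (A, e n) \<in> D')) \<and>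
    (\<forall>A q. (A, q) \<in> D \<longrightarrow> ltQ q (e n) \<longrightarrow>
      (\<exists>B B'. (B, e n) \<in> D' \<and> (B', q) \<in> D' \<and> B \<subseteq> A \<and> B' \<subseteq> A \<and> B \<noteq> B'))" for n D D'
  have "\<exists>D. \<forall>n. (labelled_family (D n) \<and> (n = 0 \<longrightarrow> D n = D0)) \<and> step n (D n) (D (Suc n))"
  proof (rule dependent_nat_choice)
    show "\<exists>x. labelled_family x \<and> (0 = (0::nat) \<longrightarrow> x = D0)" using D0 by blast
  next
    fix x and n :: nat assume "labelled_family x \<and> (n = 0 \<longrightarrow> x = D0)"
    then show "\<exists>y. (labelled_family y \<and> (Suc n = 0 \<longrightarrow> y = D0)) \<and> step n x y"
      unfolding step_def using refine_step[OF _ c e] by simp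
  qed
  then obtain D where D: "\<And>n. labelled_family (D n)" "D 0 = D0" and st: "\<And>n. step n (D n) (D (Suc n))"
    by blast
  have ref: "refines_family (D m) (D n)" if "n \<le> m" for n m
    using that
  proof (induction m rule: dec_induct)
    case base
    show ?case using refines_family_refl D(1) by blast
  next
    case (step m)
    then show ?case
      using refines_family_trans[OF D(1) D(1) D(1)] st[of m] unfolding step_def by blast
  qed
  have "labelled_chain W P ltP Z Q ltQ \<alpha> D"
  proof unfold_locales
    show "labelled_family (D n)" for n by (rule D)
    show "refines_family (D (Suc n)) (D n)" for n using ref by simp
    show "\<exists>n. \<forall>w\<in>C. \<exists>A q. (A, q) \<in> D n \<and> w \<in> A \<and> A \<subseteq> C" if C: "compact_open_in W C" for C
    proof -
      obtain n where "c n = C" using c_surj[OF C] by blast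
      then show ?thesis using st[of n] unfolding step_def by blast
    qed
    show "\<exists>m\<ge>n. \<exists>B B'. (B, r) \<in> D m \<and> (B', q) \<in> D m \<and> B \<subseteq> A \<and> B' \<subseteq> A \<and> B \<noteq> B'"
      if A: "(A, q) \<in> D n" and r: "r \<in> Q" "ltQ q r" for A q n r
    proof -
      obtain m where m: "n \<le> m" "e m = r" using e_surj[OF r(1)] by blast
      obtain A1 where A1: "(A1, q) \<in> D m" "A1 \<subseteq> A" using refines_familyD(3)[OF ref[OF m(1)] A] by blast
      then obtain B B' where B: "(B, r) \<in> D (Suc m)" "(B', q) \<in> D (Suc m)" "B \<subseteq> A1" "B' \<subseteq> A1" "B \<noteq> B'"
        using st[of m] r(2) m(2) unfolding step_def by metis
      then have "B \<subseteq> A" "B' \<subseteq> A" using A1(2) by auto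
      moreover have "n \<le> Suc m" using m(1) by simp
      ultimately show ?thesis using B by blast
    qed
    show "\<exists>n A r. (A, r) \<in> D n \<and> po_le ltQ r q" if q: "q \<in> Q" for q
    proof (cases "\<exists>A r. (A, r) \<in> D0 \<and> po_le ltQ r q")
      case True
      then show ?thesis using D(2) by metis
    next
      case False
      obtain n where "e n = q" using e_surj[OF q] by blast
      then obtain A where "(A, q) \<in> D (Suc n)"
        using ex[OF q] False st[of n] unfolding step_def by blast
      then show ?thesis by (auto simp: po_le_def)
    qed
  qed
  then show thesis by (rule that)
qed


section \<open>Finite foundations and finite fibres\<close>

lemma lower_preimage:
  assumes "lower_subset P ltP L" "q \<in> Q" "r \<in> Q" "po_le ltQ q r" "\<alpha> r \<in> L"
  shows "\<alpha> q \<in> L"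
proof (cases "q = r")
  case False
  then have "ltP (\<alpha> q) (\<alpha> r)" using assms morphism_less by (auto simp: po_le_def)
  then have "\<alpha> q \<in> down_set P ltP L"
    using assms \<alpha>_in_P by (auto simp: down_set_def po_le_def)
  then show ?thesis using assms(1) by (simp add: lower_subset_def)
qed (use assms in simp)

lemma down_set_preimage:
  assumes "lower_subset P ltP L"
  shows "down_set Q ltQ {q \<in> Q. \<alpha> q \<in> L} = {q \<in> Q. \<alpha> q \<in> L}"
  using lower_preimage[OF assms] by (auto simp: down_set_def po_le_def)

text \<open>A finite set of points has no limit points, so a finite \<open>Z p\<close> leaves nothing below \<open>p\<close>,
  not even \<open>p\<close> itself.\<close>

lemma finite_Z_minimal:
  assumes "p \<in> L" "L \<subseteq> P" "finite (Z p)"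
  shows "p \<in> po_discrete_minimals P ltP L"
proof -
  have "W derived_set_of (Z p) = {}"
    using assms(3) Hausdorff_imp_t1_space[OF hausdorff] by (simp add: t1_space_derived_set_of_finite)
  then have "\<not> ltP q p" if "q \<in> P" for q
    using derived_set_Z[OF that, of p] Z_nonempty[OF that] assms(1,2) by blast
  then show ?thesis
    using assms(1,2) by (auto simp: po_discrete_minimals_def po_minimals_def po_discrete_def po_le_def)
qed

lemma choose_distinct_points:
  assumes F: "finite F" "F \<subseteq> Q"
    and card: "\<And>p. p \<in> \<alpha> ` F \<Longrightarrow> finite (Z p) \<Longrightarrow> card {q \<in> F. \<alpha> q = p} \<le> card (Z p)"
  obtains x where "inj_on x F" "\<And>q. q \<in> F \<Longrightarrow> x q \<in> Z (\<alpha> q)"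
proof -
  have "\<exists>g. g ` {q \<in> F. \<alpha> q = p} \<subseteq> Z p \<and> inj_on g {q \<in> F. \<alpha> q = p}" if p: "p \<in> \<alpha> ` F" for p
  proof -
    have "\<exists>B. B \<subseteq> Z p \<and> finite B \<and> card {q \<in> F. \<alpha> q = p} \<le> card B"
    proof (cases "finite (Z p)")
      case True
      then show ?thesis using card[OF p] by blast
    next
      case False
      then show ?thesis using infinite_arbitrarily_large[OF False] by (metis order_refl)
    qed
    then obtain B where "B \<subseteq> Z p" "finite B" "card {q \<in> F. \<alpha> q = p} \<le> card B" by blast
    moreover have "finite {q \<in> F. \<alpha> q = p}" using F(1) by simp
    ultimately show ?thesis using card_le_inj[of "{q \<in> F. \<alpha> q = p}" B] by (meson subset_trans)
  qed
  then obtain g where g: "\<And>p. p \<in> \<alpha> ` F \<Longrightarrow> g p ` {q \<in> F. \<alpha> q = p} \<subseteq> Z p"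
    "\<And>p. p \<in> \<alpha> ` F \<Longrightarrow> inj_on (g p) {q \<in> F. \<alpha> q = p}" by metis
  let ?x = "\<lambda>q. g (\<alpha> q) q"
  have x: "?x q \<in> Z (\<alpha> q)" if "q \<in> F" for q using g(1)[of "\<alpha> q"] that by blast
  have "inj_on ?x F"
  proof (rule inj_onI)
    fix q r assume qr: "q \<in> F" "r \<in> F" "?x q = ?x r"
    then have "?x q \<in> Z (\<alpha> q)" "?x q \<in> Z (\<alpha> r)" using x[of q] x[of r] by auto
    then have "\<alpha> q = \<alpha> r" using Z_disjoint[of "\<alpha> q" "\<alpha> r"] qr(1,2) F(2) \<alpha>_in_P by blast
    then show "q = r" using inj_onD[OF g(2)[of "\<alpha> q"], of q r] qr by simp
  qed
  with x that show thesis by blast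
qed

text \<open>Every trim set of \<open>Y\<close> that meets the closure of the union of the \<open>Z p\<close> with \<open>p \<in> L\<close> has
  its label in the preimage of \<open>L\<close>: inside it there is a trim set of \<open>Z\<close> with label in \<open>L\<close>, which
  by regularity contains points of \<open>Y\<close> of a type over \<open>L\<close>. The labels of a finite cover form
  the foundation.\<close>

lemma refined_imp_finite_foundation:
  assumes L: "lower_subset P ltP L" and Y: "trim_partition W Q ltQ Y"
    and reg: "regularly_refines W Q ltQ Y \<alpha> P ltP Z"
    and bounded: "compactin W (W closure_of (\<Union>p\<in>L. Z p))"
  shows "has_finite_foundation Q ltQ {q \<in> Q. \<alpha> q \<in> L}"
proof -
  interpret Y: trim_partitioned_stone_space W Q ltQ Y
    using stone poQ Y by unfold_locales
  let ?S = "{q \<in> Q. \<alpha> q \<in> L}" and ?C = "W closure_of (\<Union>p\<in>L. Z p)"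
  have LP: "L \<subseteq> P" using L by (simp add: lower_subset_def)
  have Lin: "p \<in> L" if "p \<in> P" "po_le ltP p s" "s \<in> L" for p s
    using L that by (auto simp: lower_subset_def down_set_def)
  let ?\<U> = "{A. \<exists>q\<in>?S. A \<in> Trim W Q ltQ Y q}"
  have "?C \<subseteq> \<Union>?\<U>"
  proof
    fix w assume w: "w \<in> ?C"
    then have "w \<in> topspace W" by (simp add: in_closure_of)
    then obtain A q where q: "q \<in> Q" and A: "A \<in> Trim W Q ltQ Y q" "w \<in> A"
      using Y.trim_base[of "topspace W" w] by blast
    obtain B p where p: "p \<in> P" and B: "B \<in> Trim W P ltP Z p" "w \<in> B" "B \<subseteq> A"
      using trim_base[OF Y.Trim_openin[OF A(1)] A(2)] .
    obtain s x where s: "s \<in> L" "x \<in> Z s" "x \<in> B"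
      using w B Trim_openin[OF B(1)] unfolding in_closure_of by blast
    have "po_le ltP p s" using B(1) p s LP by (auto simp: Trim_iff)
    then have pL: "p \<in> L" using Lin p s(1) by blast
    have "p \<in> po_hat W P ltP Z" using p B(1) by (auto simp: po_hat_def)
    then have "p \<in> \<alpha> ` type_of_set Q Y B"
      using reg B(1) by (simp add: regularly_refines_def)
    then obtain r where r: "r \<in> Q" "\<alpha> r = p" "B \<inter> Y r \<noteq> {}"
      unfolding type_of_set_def by blast
    then have "A \<inter> Y r \<noteq> {}" using B(3) by blast
    then have "po_le ltQ q r" using A(1) q r(1) by (simp add: Y.Trim_iff)
    then have "\<alpha> q \<in> L" using lower_preimage[OF L q r(1)] r(2) pL by blast
    then show "w \<in> \<Union>?\<U>" using q A by blast
  qed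
  moreover have "openin W U" if "U \<in> ?\<U>" for U using that Y.Trim_openin by blast
  ultimately obtain \<V> where \<V>: "finite \<V>" "\<V> \<subseteq> ?\<U>" "?C \<subseteq> \<Union>\<V>"
    using compactinD[OF bounded, of ?\<U>] by blast
  then have "\<And>A. A \<in> \<V> \<Longrightarrow> \<exists>q. q \<in> ?S \<and> A \<in> Trim W Q ltQ Y q" by blast
  then obtain l where l: "\<And>A. A \<in> \<V> \<Longrightarrow> l A \<in> ?S \<and> A \<in> Trim W Q ltQ Y (l A)" by metis
  have "finite_foundation Q ltQ ?S (l ` \<V>)"
    unfolding finite_foundation_def down_set_preimage[OF L]
  proof (intro conjI subsetI)
    show "finite (l ` \<V>)" using \<V>(1) by simp
    show "q \<in> ?S" if "q \<in> l ` \<V>" for q using that l by blast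
    fix q assume q: "q \<in> ?S"
    then obtain y where y: "y \<in> Y q" using Y.Z_nonempty by blast
    then have "y \<in> Z (\<alpha> q)" using reg q by (auto simp: regularly_refines_def)
    then have "y \<in> (\<Union>p\<in>L. Z p)" using q by blast
    moreover have "(\<Union>p\<in>L. Z p) \<subseteq> topspace W" using Z_subset LP by blast
    ultimately have "y \<in> ?C" using closure_of_subset by blast
    then obtain A where A: "A \<in> \<V>" "y \<in> A" using \<V>(3) by blast
    then have "A \<inter> Y q \<noteq> {}" using y by blast
    moreover have "l A \<in> Q" "A \<in> Trim W Q ltQ Y (l A)" using l[OF A(1)] by auto
    ultimately have "po_le ltQ (l A) q" using q by (simp add: Y.Trim_iff)
    then show "q \<in> up_set Q ltQ (l ` \<V>)" using A(1) q by (auto simp: up_set_def)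
  qed
  then show ?thesis by (auto simp: has_finite_foundation_def)
qed

lemma refined_imp_fibre_bound:
  assumes Y: "po_partition W Q ltQ Y" "\<And>q. q \<in> Q \<Longrightarrow> Y q \<subseteq> Z (\<alpha> q)" and fin: "finite (Z p)"
  shows "finite {q \<in> Q. \<alpha> q = p} \<and> card {q \<in> Q. \<alpha> q = p} \<le> card (Z p)"
proof -
  let ?S = "{q \<in> Q. \<alpha> q = p}"
  have "\<And>q. q \<in> Q \<Longrightarrow> \<exists>y. y \<in> Y q" using Y(1) by (auto simp: po_partition_def)
  then obtain y where y: "\<And>q. q \<in> Q \<Longrightarrow> y q \<in> Y q" by metis
  have "inj_on y ?S"
  proof (rule inj_onI)
    fix q r assume qr: "q \<in> ?S" "r \<in> ?S" "y q = y r"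
    then have "Y q \<inter> Y r \<noteq> {}" using y[of q] y[of r] by auto
    moreover have "disjoint_family_on Y Q" using Y(1) by (simp add: po_partition_def)
    ultimately show "q = r" using qr(1,2) by (auto simp: disjoint_family_on_def)
  qed
  moreover have "y ` ?S \<subseteq> Z p"
  proof (rule image_subsetI)
    fix q assume "q \<in> ?S"
    then show "y q \<in> Z p" using y[of q] Y(2)[of q] by auto
  qed
  ultimately show ?thesis using fin inj_on_finite[of y ?S "Z p"] card_inj_on_le[of y ?S "Z p"] by simp
qed

text \<open>It suffices that the initial family has the elements of a finite foundation as labels,
  since every other label over \<open>L\<close> then lies above one of these.\<close>

lemma refinement_exists:
  assumes co: "countable {A. compact_open_in W A}" and Q: "countable Q"
    and L: "lower_subset P ltP L"
    and Lcomp: "\<And>p. p \<in> P \<Longrightarrow> p \<notin> L \<Longrightarrow> \<not> compactin W (W closure_of Z p)"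
    and found: "has_finite_foundation Q ltQ {q \<in> Q. \<alpha> q \<in> L}"
    and fibre: "\<And>p. p \<in> po_discrete_minimals P ltP L \<Longrightarrow>
      finite {q \<in> Q. \<alpha> q = p} \<and> card {q \<in> Q. \<alpha> q = p} \<le> card (Z p)"
  obtains Y where "trim_partition W Q ltQ Y" "regularly_refines W Q ltQ Y \<alpha> P ltP Z"
proof -
  obtain F where F: "finite F" "F \<subseteq> {q \<in> Q. \<alpha> q \<in> L}" "{q \<in> Q. \<alpha> q \<in> L} \<subseteq> up_set Q ltQ F"
    using found down_set_preimage[OF L]
    by (auto simp: has_finite_foundation_def finite_foundation_def)
  have FQ: "F \<subseteq> Q" and LP: "L \<subseteq> P" using F(2) L by (auto simp: lower_subset_def)
  have "card {q \<in> F. \<alpha> q = p} \<le> card (Z p)" if p: "p \<in> \<alpha> ` F" "finite (Z p)" for p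
  proof -
    have "p \<in> po_discrete_minimals P ltP L" using finite_Z_minimal[OF _ LP p(2)] p(1) F(2) by blast
    then have "finite {q \<in> Q. \<alpha> q = p} \<and> card {q \<in> Q. \<alpha> q = p} \<le> card (Z p)" by (rule fibre)
    moreover have "{q \<in> F. \<alpha> q = p} \<subseteq> {q \<in> Q. \<alpha> q = p}" using FQ by blast
    ultimately show ?thesis by (meson card_mono order_trans)
  qed
  then obtain x where x: "inj_on x F" "\<And>q. q \<in> F \<Longrightarrow> x q \<in> Z (\<alpha> q)"
    using choose_distinct_points[OF F(1) FQ] by blast
  obtain D0 where D0: "labelled_family D0" "\<And>q. q \<in> F \<Longrightarrow> \<exists>A. (A, q) \<in> D0"
    using labelled_family_with_labels[OF F(1) FQ x] by blast
  have ex: "(\<exists>A r. (A, r) \<in> D0 \<and> po_le ltQ r q) \<or> \<not> compactin W (W closure_of Z (\<alpha> q))"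
    if q: "q \<in> Q" for q
  proof (cases "\<alpha> q \<in> L")
    case True
    then have "q \<in> up_set Q ltQ F" using F(3) q by blast
    then show ?thesis using D0(2) by (auto simp: up_set_def)
  next
    case False
    then show ?thesis using Lcomp \<alpha>_in_P[OF q] by blast
  qed
  show thesis
  proof (cases "Q = {}")
    case True
    \<comment> \<open>Then \<open>P\<close> is empty, and so is \<open>W\<close>, by the first trimness condition.\<close>
    then have "topspace W = {}"
      using trim_base[of "topspace W"] surjective by blast
    then have "trim_partition W Q ltQ (\<lambda>_. {})" "regularly_refines W Q ltQ (\<lambda>_. {}) \<alpha> P ltP Z"
      using True surjective trim
      by (auto simp: trim_partition_def po_partition_def trim_T1_def trim_T2_def trim_T3_def
          regularly_refines_def po_hat_def disjoint_family_on_def)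
    then show thesis using that by blast
  next
    case False
    obtain D where "labelled_chain W P ltP Z Q ltQ \<alpha> D"
      using ex_labelled_chain[OF co Q False D0(1) ex] by blast
    then interpret labelled_chain W P ltP Z Q ltQ \<alpha> D .
    show thesis using that limit_class_trim_partition limit_class_regularly_refines by blast
  qed
qed

end

theorem theorem3p29:
  fixes W :: "'a topology"
    and P L :: "'p set" and ltP :: "'p \<Rightarrow> 'p \<Rightarrow> bool" and f :: "'p \<Rightarrow> nat"
    and Z :: "'p \<Rightarrow> 'a set"
    and Q :: "'q set" and ltQ :: "'q \<Rightarrow> 'q \<Rightarrow> bool"
    and \<alpha> :: "'q \<Rightarrow> 'p"
  assumes "extended_po_system P ltP L f" and "countable P"
    and "omega_stone_space W"
    and "bounded_trim_ext_partition W P ltP L f Z"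
    and "po_system Q ltQ" and "countable Q"
    and "po_morphism Q ltQ P ltP \<alpha>" and "\<alpha> ` Q = P"
  shows "(\<exists>Y :: 'q \<Rightarrow> 'a set. trim_partition W Q ltQ Y \<and> regularly_refines W Q ltQ Y \<alpha> P ltP Z) \<longleftrightarrow>
     has_finite_foundation Q ltQ {q \<in> Q. \<alpha> q \<in> L} \<and>
     (\<forall>p\<in>po_discrete_minimals P ltP L.
        finite {q \<in> Q. \<alpha> q = p} \<and> card {q \<in> Q. \<alpha> q = p} \<le> f p)"
proof -
  have L: "po_system P ltP" "lower_subset P ltP L"
    and f: "\<And>p. p \<in> po_discrete_minimals P ltP L \<Longrightarrow> 0 < f p"
    using assms(1) by (auto simp: extended_po_system_def)
  have Z: "trim_partition W P ltP Z"
    and comp: "\<And>p. p \<in> P \<Longrightarrow> compactin W (W closure_of (Z p)) \<longleftrightarrow> p \<in> L"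
    and card: "\<And>p. p \<in> po_discrete_minimals P ltP L \<Longrightarrow> card (Z p) = f p"
    and bounded: "compactin W (W closure_of (\<Union>p\<in>L. Z p))"
    using assms(4) by (auto simp: bounded_trim_ext_partition_def trim_ext_partition_def)
  have W: "stone_space W" "countable {A. compact_open_in W A}"
    using assms(3) by (auto simp: omega_stone_space_def)
  interpret trim_labelling W P ltP Z Q ltQ \<alpha>
    using W(1) L(1) Z assms(5,7,8) by unfold_locales
  show ?thesis
  proof (intro iffI conjI ballI)
    assume "\<exists>Y :: 'q \<Rightarrow> 'a set. trim_partition W Q ltQ Y \<and> regularly_refines W Q ltQ Y \<alpha> P ltP Z"
    then obtain Y :: "'q \<Rightarrow> 'a set" where Y: "trim_partition W Q ltQ Y"
      and reg: "regularly_refines W Q ltQ Y \<alpha> P ltP Z" by blast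
    show "has_finite_foundation Q ltQ {q \<in> Q. \<alpha> q \<in> L}"
      using refined_imp_finite_foundation[OF L(2) Y reg bounded] .
    fix p assume p: "p \<in> po_discrete_minimals P ltP L"
    have "finite (Z p)" using card[OF p] f[OF p] by (auto intro: card_ge_0_finite)
    then show "finite {q \<in> Q. \<alpha> q = p}" "card {q \<in> Q. \<alpha> q = p} \<le> f p"
      using refined_imp_fibre_bound[of Y p] reg card[OF p] by (auto simp: regularly_refines_def)
  next
    assume R: "has_finite_foundation Q ltQ {q \<in> Q. \<alpha> q \<in> L} \<and>
      (\<forall>p\<in>po_discrete_minimals P ltP L.
        finite {q \<in> Q. \<alpha> q = p} \<and> card {q \<in> Q. \<alpha> q = p} \<le> f p)"
    obtain Y where "trim_partition W Q ltQ Y" "regularly_refines W Q ltQ Y \<alpha> P ltP Z"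
    proof (rule refinement_exists[OF W(2) assms(6) L(2)])
      show "has_finite_foundation Q ltQ {q \<in> Q. \<alpha> q \<in> L}" using R by blast
      show "\<not> compactin W (W closure_of Z p)" if "p \<in> P" "p \<notin> L" for p using comp that by blast
      show "finite {q \<in> Q. \<alpha> q = p} \<and> card {q \<in> Q. \<alpha> q = p} \<le> card (Z p)"
        if "p \<in> po_discrete_minimals P ltP L" for p using R that card[OF that] by simp
    qed
    then show "\<exists>Y :: 'q \<Rightarrow> 'a set. trim_partition W Q ltQ Y \<and> regularly_refines W Q ltQ Y \<alpha> P ltP Z"
      by blast
  qed
qed

end
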